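(* Let $\mathbb F\in\{\mathbb R,\mathbb C\}$ and let $\mathcal X,\mathcal Y$ be normed spaces over $\mathbb F$. If the orthodigraph $\Gamma(\mathcal X)$ is finite-dimensional (i.e. $\dim\Gamma(\mathcal X)<\infty$), then every digraph isomorphism $\Gamma(\mathcal X)\to\Gamma(\mathcal Y)$ maps smooth points onto smooth points and maps maximal faces onto maximal faces. Furthermore, (if such an isomorphism exists) $\mathcal Y$ is finite-dimensional and $\dim\mathcal X=\dim\mathcal Y$.
   Context: For $x,y$ in a normed space $\mathcal X$ over $\mathbb F$, $x\perp y$ (Birkhoff--James orthogonality) means $\|x+\lambda y\|\ge\|x\|$ for all $\lambda\in\mathbb F$. The orthodigraph $\Gamma(\mathcal X)$ is the directed graph whose vertex set is the projective space $\mathbb P(\mathcal X)=\{[x]=\mathbb F x : x\in\mathcal X\setminus\{0\}\}$, with an edge $[x]\rightarrow[y]$ if and only if $x\perp y$ (independent of representatives); it has no loops. A digraph isomorphism is a bijection of vertices preserving edges in both directions. For a vertex $v$ of a digraph, $v^\perp=\{w : v\rightarrow w\}$. A clique is a set of pairwise connected vertices ($u\to v$ and $v\to u$ for all distinct $u,v$ in the set). Dimension of a loopless digraph $\hat\Gamma$: $\dim\hat\Gamma=\infty$ if $\hat\Gamma$ contains an infinite clique; if $\hat\Gamma$ has finite clique number, then $\dim\hat\Gamma=\min\{|\Omega| : \Omega$ is a finite subset of vertices with $\bigcap_{x\in\Omega}x^\perp=\varnothing\}$ (with $\min\varnothing=\infty$; an intersection over the empty set is the whole vertex set). Smooth points: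 a supporting functional of a nonzero $x\in\mathcal X$ is $f\in\mathcal X^*$ with $\|f\|=1$, $f(x)=\|x\|$; $x$ is smooth if it has a unique supporting functional; $[x]\in\mathbb P(\mathcal X)$ is smooth if some (equivalently every) nonzero representative is smooth. Faces: a face of the norm's unit ball is a convex subset $F$ of the unit sphere such that if $x,y$ are distinct normalized vectors whose open line segment $\{\lambda x+(1-\lambda)y : 0<\lambda<1\}$ intersects $F$, then $x,y\in F$. A subset $\mathcal F\subseteq\mathbb P(\mathcal X)$ is a face if one can choose a representative of each element of $\mathcal F$ so that the set of these representatives is a face of the unit ball of $\mathcal X$. A face is maximal if it is not properly contained in a bigger face. *)

theory Defs
  imports "HOL-Analysis.Analysis" "Graph_Theory.Pair_Digraph"
begin

text \<open>
  The scalar field is \<open>\<real>\<close> or \<open>\<complex>\<close>: the two cases are treated uniformly by a type class whose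
  members are isomorphic, as fields over \<open>\<real>\<close> with absolute value, to one of the two.
\<close>

class real_or_complex = real_normed_field +
  assumes real_or_complex:
    "\<exists>j :: 'a \<Rightarrow> complex.
       (\<forall>a b. j (a + b) = j a + j b) \<and> (\<forall>a b. j (a * b) = j a * j b) \<and>
       j 1 = 1 \<and> (\<forall>r a. j (r *\<^sub>R a) = r *\<^sub>R j a) \<and> (\<forall>a. cmod (j a) = norm a) \<and>
       (range j = \<real> \<or> range j = UNIV)"

instance real :: real_or_complex
  by standard (rule exI[of _ complex_of_real], auto simp: Reals_def scaleR_conv_of_real)

instance complex :: real_or_complex
  by standard (rule exI[of _ "\<lambda>z. z"], auto)

text \<open>
  A normed space over \<open>'f\<close>. The type class provides the additive group, the norm and the
  underlying real normed space; \<open>smul\<close> is the full scalar multiplication.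
\<close>

locale normed_space_over = vector_space smul
  for smul :: "'f::real_or_complex \<Rightarrow> 'a::real_normed_vector \<Rightarrow> 'a" +
  assumes smul_of_real: "smul (of_real r) x = r *\<^sub>R x"
    and norm_smul: "norm (smul c x) = norm c * norm x"

lemma normed_space_over_scaleR:
  "normed_space_over (scaleR :: real \<Rightarrow> 'a::real_normed_vector \<Rightarrow> 'a)"
  by unfold_locales (auto simp: algebra_simps)

text \<open>Dimension in the sense of linear algebra; \<^const>\<open>vector_space.dim\<close> is a natural
  number, with value \<open>0\<close> on infinite-dimensional spaces, so finiteness has to be stated apart.\<close>

definition finite_dimensional ::
    "('f::real_or_complex \<Rightarrow> 'a::real_normed_vector \<Rightarrow> 'a) \<Rightarrow> bool" where
  "finite_dimensional smul \<longleftrightarrow> (\<exists>B. finite B \<and> module.span smul B = UNIV)"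

definition digraph_isomorphism ::
    "'u pair_pre_digraph \<Rightarrow> 'v pair_pre_digraph \<Rightarrow> ('u \<Rightarrow> 'v) \<Rightarrow> bool" where
  "digraph_isomorphism G H \<phi> \<longleftrightarrow>
     bij_betw \<phi> (pverts G) (pverts H) \<and>
     (\<forall>u\<in>pverts G. \<forall>v\<in>pverts G. (u, v) \<in> parcs G \<longleftrightarrow> (\<phi> u, \<phi> v) \<in> parcs H)"

definition out_perp :: "'v pair_pre_digraph \<Rightarrow> 'v \<Rightarrow> 'v set" where
  "out_perp G v = {w \<in> pverts G. (v, w) \<in> parcs G}"

definition is_clique :: "'v pair_pre_digraph \<Rightarrow> 'v set \<Rightarrow> bool" where
  "is_clique G C \<longleftrightarrow>
     C \<subseteq> pverts G \<and> (\<forall>u\<in>C. \<forall>v\<in>C. u \<noteq> v \<longrightarrow> (u, v) \<in> parcs G \<and> (v, u) \<in> parcs G)"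

text \<open>
  Intersecting with the vertex set only matters for \<open>\<Omega> = {}\<close>, where the intersection has to be the
  whole vertex set. The infimum in \<^typ>\<open>enat\<close> is attained if the set is nonempty, and is \<open>\<infinity>\<close> otherwise.
  A digraph with finite cliques of unbounded size but no infinite clique falls under the second
  branch; for orthodigraphs this does not occur in finite-dimensional spaces, and in
  infinite-dimensional ones the infimum is \<open>\<infinity>\<close> anyway.
\<close>

definition digraph_dim :: "'v pair_pre_digraph \<Rightarrow> enat" where
  "digraph_dim G =
     (if \<exists>C. is_clique G C \<and> infinite C then \<infinity>
      else Inf {enat (card \<Omega>) | \<Omega>. finite \<Omega> \<and> \<Omega> \<subseteq> pverts G \<and>
                                  pverts G \<inter> (\<Inter>x\<in>\<Omega>. out_perp G x) = {}})"

context
  fixes smul :: "'f::real_or_complex \<Rightarrow> 'a::real_normed_vector \<Rightarrow> 'a"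
begin

definition bj_orthogonal :: "'a \<Rightarrow> 'a \<Rightarrow> bool" where
  "bj_orthogonal x y \<longleftrightarrow> (\<forall>c. norm (x + smul c y) \<ge> norm x)"

definition line :: "'a \<Rightarrow> 'a set" where
  "line x = range (\<lambda>c. smul c x)"

definition proj_space :: "'a set set" where
  "proj_space = {line x | x. x \<noteq> 0}"

definition orthodigraph :: "'a set pair_pre_digraph" where
  "orthodigraph =
     \<lparr> pverts = proj_space,
       parcs = {(line x, line y) | x y. x \<noteq> 0 \<and> y \<noteq> 0 \<and> bj_orthogonal x y} \<rparr>"

definition supporting_functional :: "'a \<Rightarrow> ('a \<Rightarrow> 'f) \<Rightarrow> bool" where
  "supporting_functional x f \<longleftrightarrow>
     Vector_Spaces.linear smul (*) f \<and> bounded_linear f \<and>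
     onorm f = 1 \<and> f x = of_real (norm x)"

definition smooth_vector :: "'a \<Rightarrow> bool" where
  "smooth_vector x \<longleftrightarrow> x \<noteq> 0 \<and> (\<exists>!f. supporting_functional x f)"

definition smooth_points :: "'a set set" where
  "smooth_points = {line x | x. smooth_vector x}"

text \<open>Only the underlying real structure enters here, as segments and convexity are real notions.
  \<^const>\<open>face_of\<close> is not used because its segment endpoints range over the whole ball rather than
  over the sphere.\<close>

definition ball_face :: "'a set \<Rightarrow> bool" where
  "ball_face F \<longleftrightarrow>
     convex F \<and> F \<subseteq> sphere 0 1 \<and>
     (\<forall>x y. norm x = 1 \<and> norm y = 1 \<and> x \<noteq> y \<and> open_segment x y \<inter> F \<noteq> {} \<longrightarrow> x \<in> F \<and> y \<in> F)"

definition proj_face :: "'a set set \<Rightarrow> bool" where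
  "proj_face \<F> \<longleftrightarrow>
     \<F> \<subseteq> proj_space \<and>
     (\<exists>r. (\<forall>L\<in>\<F>. r L \<noteq> 0 \<and> line (r L) = L) \<and> ball_face (r ` \<F>))"

definition maximal_faces :: "'a set set set" where
  "maximal_faces = {\<F>. proj_face \<F> \<and> (\<nexists>\<G>. proj_face \<G> \<and> \<F> \<subset> \<G>)}"

end

lemma orthodigraph_arc_iff:
  assumes "normed_space_over smul" "x \<noteq> 0" "y \<noteq> 0"
  shows "(line smul x, line smul y) \<in> parcs (orthodigraph smul) \<longleftrightarrow> bj_orthogonal smul x y"
proof -
  interpret normed_space_over smul by fact
  have rep: "\<exists>a. a \<noteq> 0 \<and> u = smul a v" if "line smul u = line smul v" "u \<noteq> 0" for u v
  proof -
    have "u \<in> line smul u" unfolding line_def by (rule range_eqI[of _ _ 1]) simp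
    then have "u \<in> line smul v" by (simp only: that(1))
    then obtain a where "u = smul a v" by (auto simp: line_def)
    with that(2) show ?thesis by (metis scale_zero_left)
  qed
  have "bj_orthogonal smul x y" if o: "bj_orthogonal smul u v" and "x = smul a u" "y = smul b v"
    "a \<noteq> 0" for u v a b
    unfolding bj_orthogonal_def
  proof
    fix c
    have "x + smul c y = smul a (u + smul (c * b / a) v)"
      using that by (simp add: scale_right_distrib)
    then show "norm x \<le> norm (x + smul c y)"
      using o that by (simp add: bj_orthogonal_def norm_smul mult_left_mono)
  qed
  note bj = this
  show ?thesis
  proof
    assume "(line smul x, line smul y) \<in> parcs (orthodigraph smul)"
    then obtain u v where uv: "line smul x = line smul u" "line smul y = line smul v" "bj_orthogonal smul u v"
      by (auto simp: orthodigraph_def)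
    obtain a b where "a \<noteq> 0" "x = smul a u" "y = smul b v"
      using rep[OF uv(1) assms(2)] rep[OF uv(2) assms(3)] by blast
    then show "bj_orthogonal smul x y" using bj[OF uv(3)] by blast
  next
    assume "bj_orthogonal smul x y"
    then show "(line smul x, line smul y) \<in> parcs (orthodigraph smul)"
      using assms(2,3) by (auto simp: orthodigraph_def)
  qed
qed

end

theory Submission
  imports Defs
begin

text \<open>
  Both notions are recovered from the orthodigraph. Let \<open>n\<close> be the dimension of the space. By
  Hahn-Banach, the out-neighbourhood of \<open>[x]\<close> is the union of the kernels of the functionals
  supporting \<open>x\<close>; so fewer than \<open>n\<close> vertices always have a common out-neighbour, and \<open>[x]\<close> is smooth
  iff its out-neighbourhood is a hyperplane. Smooth points abound, so each one belongs to \<open>n\<close>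
  smooth points whose hyperplanes are in general position. Conversely, if \<open>n\<close> vertices have no common
  out-neighbour while any \<open>n - 1\<close> of them have exactly one, then these \<open>n\<close> common neighbours
  determine all supporting functionals up to scalars, so that the vertices are smooth.
  The maximal faces are the maximal sets of the form \<open>{w. v\<^sup>\<perp> \<subseteq> w\<^sup>\<perp>}\<close>: such a set lies in the face cut
  out by any functional supporting \<open>v\<close>, and a face lies in the set given by a relative interior point \<open>v\<close>.
\<close>

subsection \<open>The scalar field\<close>

text \<open>One embedding granted by the class axiom, chosen once and for all. It gives every scalar
  a real part, so that real-linear arguments run uniformly over both fields.\<close>

definition rc_embed :: "'f::real_or_complex \<Rightarrow> complex" where
  "rc_embed = (SOME j.
     (\<forall>a b. j (a + b) = j a + j b) \<and> (\<forall>a b. j (a * b) = j a * j b) \<and>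
     j 1 = 1 \<and> (\<forall>r a. j (r *\<^sub>R a) = r *\<^sub>R j a) \<and> (\<forall>a. cmod (j a) = norm a) \<and>
     (range j = \<real> \<or> range j = UNIV))"

lemma
  fixes a b :: "'f::real_or_complex"
  shows rc_embed_add: "rc_embed (a + b) = rc_embed a + rc_embed b"
    and rc_embed_mult: "rc_embed (a * b) = rc_embed a * rc_embed b"
    and rc_embed_1: "rc_embed (1 :: 'f) = 1"
    and rc_embed_scaleR: "rc_embed (r *\<^sub>R a) = r *\<^sub>R rc_embed a"
    and norm_rc_embed: "cmod (rc_embed a) = norm a"
    and range_rc_embed: "range (rc_embed :: 'f \<Rightarrow> complex) = \<real> \<or>
      range (rc_embed :: 'f \<Rightarrow> complex) = UNIV"
  using someI_ex[OF real_or_complex[where 'a = 'f], folded rc_embed_def] by blast+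

lemma linear_rc_embed: "linear rc_embed"
  by (intro linearI rc_embed_add rc_embed_scaleR)

lemmas rc_embed_0 = linear_0[OF linear_rc_embed]
lemmas rc_embed_minus = linear_neg[OF linear_rc_embed]
lemmas rc_embed_diff = linear_diff[OF linear_rc_embed]

lemma rc_embed_eq_iff: "rc_embed a = rc_embed b \<longleftrightarrow> a = b"
  using norm_rc_embed[of "a - b"] by (auto simp: rc_embed_diff)

lemma rc_embed_of_real: "rc_embed (of_real r) = of_real r"
  by (simp add: of_real_def rc_embed_scaleR rc_embed_1)

lemma Re_rc_embed_of_real_mult: "Re (rc_embed (of_real r * a)) = r * Re (rc_embed a)"
  by (simp add: rc_embed_mult rc_embed_of_real)

lemma Re_rc_embed_le_norm: "Re (rc_embed a) \<le> norm a"
  by (metis complex_Re_le_cmod norm_rc_embed)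

text \<open>The bound forces the modulus to equal the real part, so the imaginary part vanishes.
  With it, attaining the norm can be checked on real parts.\<close>

lemma eq_norm_if_Re_rc_embed:
  fixes a :: "'f::real_or_complex"
  assumes "Re (rc_embed a) = r" "norm a \<le> r"
  shows "a = of_real r"
proof -
  have "cmod (rc_embed a) = Re (rc_embed a)"
    using assms complex_Re_le_cmod[of "rc_embed a"] by (simp add: norm_rc_embed)
  then have "Im (rc_embed a) = 0"
    using cmod_power2[of "rc_embed a"] by simp
  then have "rc_embed a = rc_embed (of_real r :: 'f)"
    using assms by (simp add: rc_embed_of_real complex_eq_iff)
  then show ?thesis by (simp add: rc_embed_eq_iff)
qed

text \<open>The equality case of averaging: the real parts are at most 1 and add up to their number,
  so each of them is 1, and the modulus bound does the rest.\<close>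

lemma sum_of_bounded_eq_card:
  fixes a :: "'i \<Rightarrow> 'f::real_or_complex"
  assumes "finite I" "\<And>i. i \<in> I \<Longrightarrow> norm (a i) \<le> 1" "(\<Sum>i\<in>I. a i) = of_nat (card I)" "i \<in> I"
  shows "a i = 1"
proof -
  let ?r = "\<lambda>i. Re (rc_embed (a i))"
  have le: "?r k \<le> 1" if "k \<in> I" for k
    using Re_rc_embed_le_norm[of "a k"] assms(2)[OF that] by simp
  have "rc_embed (\<Sum>i\<in>I. a i) = (\<Sum>i\<in>I. rc_embed (a i))"
    by (rule linear_sum[OF linear_rc_embed])
  then have "(\<Sum>k\<in>I. ?r k) = real (card I)"
    using assms(3) rc_embed_of_real[of "real (card I)", where 'a = 'f] by (simp flip: Re_sum)
  then have "(\<Sum>k\<in>I. 1 - ?r k) = 0" by (simp add: sum_subtractf)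
  then have "1 - ?r i = 0"
    using sum_nonneg_eq_0_iff[of I "\<lambda>k. 1 - ?r k"] assms(1,4) le by auto
  then show ?thesis
    using eq_norm_if_Re_rc_embed[of "a i" 1] assms(2)[OF assms(4)] by simp
qed

text \<open>The embedding is isometric with closed range, so the ball is the continuous image, under
  the inverse, of a compact set of complex numbers.\<close>

lemma compact_cball_rc: "compact (cball 0 r :: 'f::real_or_complex set)"
proof -
  let ?j = "rc_embed :: 'f \<Rightarrow> complex"
  have inj: "inj ?j" by (simp add: inj_def rc_embed_eq_iff)
  have "closed (range ?j)"
    using range_rc_embed[where 'f = 'f] closed_complex_Reals by auto
  then have 1: "compact (range ?j \<inter> cball 0 r)" by (simp add: closed_Int_compact)
  have iso: "dist (inv ?j x) (inv ?j y) = dist x y" if "x \<in> range ?j" "y \<in> range ?j" for x y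
    using that inj by (auto simp: dist_norm norm_rc_embed simp flip: rc_embed_diff)
  have 2: "continuous_on (range ?j \<inter> cball 0 r) (inv ?j)"
    unfolding continuous_on_iff using iso by auto
  have "inv ?j ` (range ?j \<inter> cball 0 r) = cball 0 r"
    using inj by (force simp: norm_rc_embed image_iff)
  then show ?thesis using compact_continuous_image[OF 2 1] by simp
qed

text \<open>The index type may be infinite. Fixing the coordinates outside \<open>I\<close> at 0
  makes the set a closed part of a product of compact balls and singletons, where Tychonoff
  applies.\<close>

lemma compact_l2_ball:
  fixes I :: "'i set"
  assumes "finite I"
  shows "compact {c :: 'i \<Rightarrow> 'f::real_or_complex.
    (\<forall>i. i \<notin> I \<longrightarrow> c i = 0) \<and> (\<Sum>i\<in>I. (norm (c i))\<^sup>2) \<le> 1}" (is "compact ?K")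
proof -
  let ?S = "\<lambda>i. if i \<in> I then cball 0 1 else {0 :: 'f}"
  have "compactin (product_topology (\<lambda>i::'i. euclidean :: 'f topology) UNIV) (PiE UNIV ?S)"
    unfolding compactin_PiE by (auto simp: compact_cball_rc)
  then have 1: "compact (PiE UNIV ?S)"
    by (simp add: euclidean_product_topology)
  have cont: "continuous_on UNIV (\<lambda>c :: 'i \<Rightarrow> 'f. \<Sum>i\<in>I. (norm (c i))\<^sup>2)"
    by (intro continuous_intros continuous_on_product_then_coordinatewise continuous_on_id)
  have 2: "closed {c :: 'i \<Rightarrow> 'f. (\<Sum>i\<in>I. (norm (c i))\<^sup>2) \<le> 1}"
    using closed_Collect_le[OF cont continuous_on_const] .
  have "?K = PiE UNIV ?S \<inter> {c. (\<Sum>i\<in>I. (norm (c i))\<^sup>2) \<le> 1}"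
  proof (intro equalityI subsetI)
    fix c assume c: "c \<in> ?K"
    have "norm (c i) \<le> 1" if "i \<in> I" for i
    proof -
      have "(norm (c i))\<^sup>2 \<le> 1"
        using member_le_sum[OF that, of "\<lambda>i. (norm (c i))\<^sup>2"] c assms by auto
      then show ?thesis by (simp add: power_le_one_iff abs_square_le_1)
    qed
    with c show "c \<in> PiE UNIV ?S \<inter> {c. (\<Sum>i\<in>I. (norm (c i))\<^sup>2) \<le> 1}" by auto
  qed (auto simp: PiE_iff split: if_splits)
  then show ?thesis using 1 2 by (simp add: compact_Int_closed)
qed

subsection \<open>Supporting functionals and Birkhoff-James orthogonality\<close>

text \<open>Partial functionals are encoded as subspaces of the product, ordered by inclusion; the
  norm bound at the vector 0 makes such a relation single-valued. Zorn gives a maximal one, and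
  extension by one dimension shows that its domain is the whole space.\<close>

lemma real_hahn_banach_graph:
  fixes G :: "('a::real_normed_vector \<times> real) set"
  assumes "subspace G" and "\<And>x a. (x, a) \<in> G \<Longrightarrow> a \<le> norm x"
  obtains u where "linear u" "\<And>x. u x \<le> norm x" "\<And>x a. (x, a) \<in> G \<Longrightarrow> u x = a"
proof -
  let ?A = "{H. subspace H \<and> G \<subseteq> H \<and> (\<forall>(x, a)\<in>H. a \<le> norm x)}"
  have "\<exists>M\<in>?A. \<forall>X\<in>?A. M \<subseteq> X \<longrightarrow> X = M"
  proof (rule subset_Zorn_nonempty)
    show "?A \<noteq> {}" using assms by auto
    fix C assume C: "C \<noteq> {}" "subset.chain ?A C"
    have sub: "H \<in> ?A" if "H \<in> C" for H using that C(2) by (auto simp: subset.chain_def)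
    have "subspace (\<Union>C)"
      unfolding subspace_def
    proof (intro conjI ballI allI)
      show "0 \<in> \<Union>C" using C(1) sub by (force dest: subspace_0)
      show "x + y \<in> \<Union>C" if xy: "x \<in> \<Union>C" "y \<in> \<Union>C" for x y
      proof -
        obtain H K where "H \<in> C" "K \<in> C" "x \<in> H" "y \<in> K" using xy by auto
        moreover have "H \<subseteq> K \<or> K \<subseteq> H"
          using C(2) \<open>H \<in> C\<close> \<open>K \<in> C\<close> by (meson subset_chain_def)
        ultimately obtain L where "L \<in> C" "x \<in> L" "y \<in> L" by blast
        then show ?thesis using sub[of L] by (auto intro: subspace_add)
      qed
      show "r *\<^sub>R x \<in> \<Union>C" if "x \<in> \<Union>C" for r x
        using that sub by (auto intro: subspace_scale)
    qed
    then show "\<Union>C \<in> ?A" using C(1) sub by fastforce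
  qed
  then obtain M where M: "subspace M" "G \<subseteq> M" "\<And>x a. (x, a) \<in> M \<Longrightarrow> a \<le> norm x"
    and max: "\<And>X. subspace X \<Longrightarrow> M \<subseteq> X \<Longrightarrow> (\<And>x a. (x, a) \<in> X \<Longrightarrow> a \<le> norm x) \<Longrightarrow> X = M"
    by (smt (verit, del_insts) case_prodI2 mem_Collect_eq case_prodD order_trans)
  have add: "(x + y, a + b) \<in> M" if "(x, a) \<in> M" "(y, b) \<in> M" for x y a b
    using subspace_add[OF M(1) that] by simp
  have scale: "(r *\<^sub>R x, r * a) \<in> M" if "(x, a) \<in> M" for x a r
    using subspace_scale[OF M(1) that, of r] by simp
  have uniq: "a = b" if "(x, a) \<in> M" "(x, b) \<in> M" for x a b
  proof -
    have d: "(0, a - b) \<in> M" using subspace_diff[OF M(1) that] by simp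
    have "(0, b - a) \<in> M" using subspace_diff[OF M(1) that(2,1)] by simp
    with d show ?thesis using M(3)[of 0 "a - b"] M(3)[of 0 "b - a"] by simp
  qed
  have total: "\<exists>a. (v, a) \<in> M" for v
  proof -
    \<comment> \<open>A value \<open>c\<close> for \<open>v\<close> is admissible iff it lies
      between all \<open>b - norm (y - v)\<close> and all \<open>norm (x + v) - a\<close>; the
      infimum of the upper bounds is taken. Positive and negative multiples of \<open>v\<close> use
      one bound each, rescaled.\<close>
    let ?T = "{norm (x + v) - a | x a. (x, a) \<in> M}"
    define c where "c = Inf ?T"
    have zero: "(0, 0) \<in> M" using subspace_0[OF M(1)] by (simp add: zero_prod_def)
    have cross: "b - norm (y - v) \<le> norm (x + v) - a" if "(x, a) \<in> M" "(y, b) \<in> M" for x y a b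
    proof -
      have "a + b \<le> norm (x + y)" using M(3)[OF add[OF that]] .
      also have "\<dots> \<le> norm (x + v) + norm (y - v)"
        using norm_triangle_ineq[of "x + v" "y - v"] by simp
      finally show ?thesis by simp
    qed
    have ne: "?T \<noteq> {}" using zero by blast
    have bdd: "bdd_below ?T"
      unfolding bdd_below_def using cross[OF _ zero] by blast
    have up: "a + c \<le> norm (x + v)" if "(x, a) \<in> M" for x a
    proof -
      have "c \<le> norm (x + v) - a" unfolding c_def using that by (intro cInf_lower[OF _ bdd]) blast
      then show ?thesis by simp
    qed
    have lo: "b - c \<le> norm (y - v)" if "(y, b) \<in> M" for y b
    proof -
      have "b - norm (y - v) \<le> c" unfolding c_def
        using cross[OF _ that] by (intro cInf_greatest[OF ne]) auto
      then show ?thesis by simp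
    qed
    have bound: "a + t * c \<le> norm (x + t *\<^sub>R v)" if "(x, a) \<in> M" for x a t
    proof -
      consider "t = 0" | "t > 0" | "t < 0" by linarith
      then show ?thesis
      proof cases
        case 1 then show ?thesis using M(3)[OF that] by simp
      next
        case 2
        have "t * ((1/t) * a + c) \<le> t * norm ((1/t) *\<^sub>R x + v)"
          using up[OF scale[OF that, of "1/t"]] 2 by (intro mult_left_mono) auto
        also have "\<dots> = norm (t *\<^sub>R ((1/t) *\<^sub>R x + v))" using 2 by simp
        finally show ?thesis using 2 by (simp add: distrib_left scaleR_right_distrib)
      next
        case 3
        have "(-t) * ((1/(-t)) * a - c) \<le> (-t) * norm ((1/(-t)) *\<^sub>R x - v)"
          using lo[OF scale[OF that, of "1/(-t)"]] 3 by (intro mult_left_mono) auto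
        also have "\<dots> = norm ((-t) *\<^sub>R ((1/(-t)) *\<^sub>R x - v))" using 3 by simp
        finally show ?thesis using 3 by (simp add: right_diff_distrib scaleR_right_diff_distrib)
      qed
    qed
    let ?X = "{p + q | p q. p \<in> M \<and> q \<in> span {(v, c)}}"
    have "?X = M"
    proof (rule max)
      show "subspace ?X" by (rule subspace_sums[OF M(1) subspace_span])
      show "M \<subseteq> ?X" using span_zero[of "{(v, c)}"] by (metis (mono_tags, lifting) add.right_neutral mem_Collect_eq subsetI)
      show "a \<le> norm x" if xa: "(x, a) \<in> ?X" for x a
      proof -
        obtain y b t where "(y, b) \<in> M" "(x, a) = (y, b) + t *\<^sub>R (v, c)"
          using xa by (auto simp: span_singleton)
        then show ?thesis using bound[of y b t] by simp
      qed
    qed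
    moreover have "(0, 0) + (v, c) \<in> ?X" using zero span_base[of "(v, c)" "{(v, c)}"] by blast
    ultimately show ?thesis by auto
  qed
  define u where "u x = (THE a. (x, a) \<in> M)" for x
  have uM: "(x, u x) \<in> M" for x
    unfolding u_def by (rule theI') (use total uniq in blast)
  have ueq: "u x = a" if "(x, a) \<in> M" for x a using uniq[OF uM that] .
  show thesis
  proof (rule that)
    show "linear u"
      by (intro linearI ueq) (auto intro: add scale uM)
    show "u x \<le> norm x" for x using M(3)[OF uM] .
    show "u x = a" if "(x, a) \<in> G" for x a using that M(2) by (auto intro: ueq)
  qed
qed

context normed_space_over
begin

lemma norm_smul_le:
  assumes "norm c \<le> r"
  shows "norm (smul c x) \<le> r * norm x"
  using assms by (simp add: norm_smul mult_right_mono)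

lemma supporting_functionalD:
  assumes "supporting_functional smul x f"
  shows "f (y + z) = f y + f z" "f (smul c y) = c * f y" "norm (f y) \<le> norm y"
    "f x = of_real (norm x)" "f 0 = 0" "f (y - z) = f y - f z" "f (sum g I) = (\<Sum>i\<in>I. f (g i))"
proof -
  have lin: "Vector_Spaces.linear smul (*) f" and bl: "bounded_linear f" and "onorm f = 1"
    and x: "f x = of_real (norm x)"
    using assms by (auto simp: supporting_functional_def)
  interpret f: Vector_Spaces.linear smul "(*)" f by fact
  show "f (y + z) = f y + f z" "f (smul c y) = c * f y" "f 0 = 0" "f (y - z) = f y - f z"
    "f (sum g I) = (\<Sum>i\<in>I. f (g i))"
    by (simp_all add: f.add f.scale f.diff f.sum)
  show "norm (f y) \<le> norm y" using onorm[OF bl, of y] \<open>onorm f = 1\<close> by simp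
  show "f x = of_real (norm x)" by fact
qed

lemma supporting_functionalI:
  assumes "x \<noteq> 0" and add: "\<And>y z. f (y + z) = f y + f z" and scale: "\<And>c y. f (smul c y) = c * f y"
    and le: "\<And>y. norm (f y) \<le> norm y" and x: "f x = of_real (norm x)"
  shows "supporting_functional smul x f"
proof -
  have lin: "Vector_Spaces.linear smul (*) f"
    by (simp add: Vector_Spaces.linear_iff vector_space_axioms vector_space_over_itself.vector_space_axioms
      add scale)
  have bl: "bounded_linear f"
    by (rule bounded_linear_intro[of f 1])
      (use le in \<open>auto simp: add scale scaleR_conv_of_real simp flip: smul_of_real\<close>)
  have "onorm f \<le> 1" using le by (intro onorm_bound) auto
  moreover have "onorm f \<ge> 1"
    using onorm[OF bl, of x] \<open>x \<noteq> 0\<close> by (simp add: x)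
  ultimately show ?thesis using lin bl x by (simp add: supporting_functional_def)
qed

text \<open>The Bohnenblust-Sobczyk trick: over the complex numbers, \<open>f x = u x - \<i> u (\<i> x)\<close>.\<close>

lemma ex_functional_Re_eq:
  assumes u: "linear u" and le: "\<And>x. u x \<le> norm x"
  obtains f where "\<And>y z. f (y + z) = f y + f z" "\<And>c y. f (smul c y) = c * f y"
    "\<And>y. norm (f y) \<le> norm y" "\<And>y. Re (rc_embed (f y)) = u y"
proof -
  note u_simps = linear_add[OF u] linear_scale[OF u] linear_diff[OF u] linear_neg[OF u]
  have "\<exists>f. (\<forall>y z. f (y + z) = f y + f z) \<and> (\<forall>c y. f (smul c y) = c * f y) \<and>
      (\<forall>y. Re (rc_embed (f y)) = u y)"
    using range_rc_embed[where 'f = 'f]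
  proof
    assume R: "range (rc_embed :: 'f \<Rightarrow> complex) = \<real>"
    have real: "\<exists>r. c = of_real r" for c :: 'f
    proof -
      have "rc_embed c \<in> \<real>" using R by blast
      then obtain r where "rc_embed c = rc_embed (of_real r :: 'f)"
        by (auto simp: rc_embed_of_real elim: Reals_cases)
      then show ?thesis by (auto simp: rc_embed_eq_iff)
    qed
    have "of_real (u (smul c y)) = c * of_real (u y)" for c y
      using real[of c] by (auto simp: smul_of_real u_simps)
    then show ?thesis
      by (intro exI[of _ "\<lambda>y. of_real (u y)"]) (auto simp: u_simps rc_embed_of_real)
  next
    assume C: "surj (rc_embed :: 'f \<Rightarrow> complex)"
    then obtain i :: 'f where i: "rc_embed i = \<i>" by (metis surjD)
    have ii: "i * i = -1"
    proof -
      have "rc_embed (i * i) = rc_embed (- 1 :: 'f)"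
        by (simp add: rc_embed_mult i rc_embed_minus rc_embed_1)
      then show ?thesis by (simp add: rc_embed_eq_iff)
    qed
    have ii': "i * (i * a) = - a" for a using ii by (simp flip: mult.assoc)
    have decomp: "\<exists>a b. c = of_real a + of_real b * i" for c :: 'f
    proof (intro exI)
      have "rc_embed c = rc_embed (of_real (Re (rc_embed c)) + of_real (Im (rc_embed c)) * i)"
        by (simp add: rc_embed_add rc_embed_mult rc_embed_of_real i complex_eq_iff)
      then show "c = of_real (Re (rc_embed c)) + of_real (Im (rc_embed c)) * i"
        by (simp add: rc_embed_eq_iff)
    qed
    define f where "f y = of_real (u y) - i * of_real (u (smul i y))" for y
    have add: "f (y + z) = f y + f z" for y z
      by (simp add: f_def u_simps scale_right_distrib algebra_simps)
    have fi: "f (smul i y) = i * f y" for y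
      by (simp add: f_def u_simps ii ii' right_diff_distrib)
    have fr: "f (smul (of_real r) y) = of_real r * f y" for r y
    proof -
      have "smul i (r *\<^sub>R y) = r *\<^sub>R smul i y"
        by (simp add: mult.commute flip: smul_of_real)
      then show ?thesis by (simp add: f_def smul_of_real u_simps algebra_simps)
    qed
    have "f (smul c y) = c * f y" for c y
    proof -
      obtain a b where c: "c = of_real a + of_real b * i" using decomp by blast
      have "smul c y = smul (of_real a) y + smul (of_real b) (smul i y)"
        by (simp add: c scale_left_distrib)
      then show ?thesis by (simp add: add fr fi c distrib_right mult.assoc del: scale_scale)
    qed
    moreover have "Re (rc_embed (f y)) = u y" for y
      by (simp add: f_def rc_embed_diff rc_embed_mult rc_embed_of_real i)
    ultimately show ?thesis using add by blast
  qed
  then obtain f where add: "\<And>y z. f (y + z) = f y + f z" and scale: "\<And>c y. f (smul c y) = c * f y"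
    and re: "\<And>y. Re (rc_embed (f y)) = u y"
    by blast
  have "norm (f y) \<le> norm y" for y
  proof (cases "f y = 0")
    case False
    \<comment> \<open>A scalar of modulus 1 that rotates \<open>f y\<close> onto the nonnegative
      real axis, where the value is already seen by \<open>u\<close>.\<close>
    define c where "c = of_real (norm (f y)) / f y"
    have "f (smul c y) = of_real (norm (f y))" using False by (simp add: scale c_def)
    then have "norm (f y) = u (smul c y)" using re[of "smul c y"] by (simp add: rc_embed_of_real)
    also have "\<dots> \<le> norm (smul c y)" by (rule le)
    also have "\<dots> = norm y" using False by (simp add: norm_smul c_def norm_divide)
    finally show ?thesis .
  qed simp
  with add scale re show thesis using that by blast
qed

lemma eq_0_if_Re_rc_embed_mult:
  assumes "\<And>c :: 'f. Re (rc_embed (c * a)) = 0"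
  shows "a = 0"
  using assms[of "inverse a"] by (cases "a = 0") (auto simp: rc_embed_1)

text \<open>James's characterisation. Hahn-Banach extends the functional that is
  \<open>norm x\<close> at \<open>x\<close> and 0 on the multiples of \<open>z\<close>;
  orthogonality is the norm bound that this needs. Conversely, \<open>f\<close> is constant on all
  \<open>x + smul c z\<close>.\<close>

theorem bj_orthogonal_iff_supporting_functional:
  assumes "x \<noteq> 0"
  shows "bj_orthogonal smul x z \<longleftrightarrow> (\<exists>f. supporting_functional smul x f \<and> f z = 0)"
proof
  assume o: "bj_orthogonal smul x z"
  \<comment> \<open>The second component ignores \<open>c\<close>, which runs over the whole scalar
    field: the extension vanishes on every multiple of \<open>z\<close>, so \<open>f z\<close>
    itself, and not only its real part, becomes 0.\<close>
  define G where "G = range (\<lambda>(r, c). (r *\<^sub>R x + smul c z, r * norm x))"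
  have G: "Real_Vector_Spaces.subspace G"
    unfolding real_vector.subspace_def
  proof (intro conjI ballI allI)
    show "0 \<in> G" unfolding G_def by (rule range_eqI[of _ _ "(0, 0)"]) (simp add: zero_prod_def)
    show "p + q \<in> G" if pq: "p \<in> G" "q \<in> G" for p q
    proof -
      obtain r c s d where "p = (r *\<^sub>R x + smul c z, r * norm x)" "q = (s *\<^sub>R x + smul d z, s * norm x)"
        using pq by (auto simp: G_def)
      then show ?thesis unfolding G_def
        by (intro range_eqI[of _ _ "(r + s, c + d)"]) (simp add: algebra_simps scale_left_distrib)
    qed
    show "t *\<^sub>R p \<in> G" if p: "p \<in> G" for t p
    proof -
      obtain r c where "p = (r *\<^sub>R x + smul c z, r * norm x)" using p by (auto simp: G_def)
      then show ?thesis unfolding G_def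
        by (intro range_eqI[of _ _ "(t * r, of_real t * c)"])
          (simp add: scale_right_distrib flip: smul_of_real)
    qed
  qed
  have bound: "a \<le> norm y" if ya: "(y, a) \<in> G" for y a
  proof -
    obtain r c where rc: "y = r *\<^sub>R x + smul c z" "a = r * norm x" using ya by (auto simp: G_def)
    show ?thesis
    proof (cases "r = 0")
      case False
      have "y = r *\<^sub>R (x + smul (c / of_real r) z)"
        using False by (simp add: rc scale_right_distrib flip: smul_of_real)
      then have "norm y = \<bar>r\<bar> * norm (x + smul (c / of_real r) z)" by simp
      also have "\<dots> \<ge> \<bar>r\<bar> * norm x"
        using o by (intro mult_left_mono) (auto simp: bj_orthogonal_def)
      finally show ?thesis using rc by (smt (verit) mult_right_mono norm_ge_zero)
    qed (simp add: rc)
  qed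
  obtain u where u: "linear u" "\<And>y. u y \<le> norm y" "\<And>y a. (y, a) \<in> G \<Longrightarrow> u y = a"
    using real_hahn_banach_graph[OF G bound] by blast
  obtain f where f: "\<And>y z. f (y + z) = f y + f z" "\<And>c y. f (smul c y) = c * f y"
    "\<And>y. norm (f y) \<le> norm y" "\<And>y. Re (rc_embed (f y)) = u y"
    using ex_functional_Re_eq[OF u(1,2)] by blast
  have "u x = norm x"
    by (rule u(3)) (auto simp: G_def intro!: range_eqI[of _ _ "(1, 0)"])
  then have "f x = of_real (norm x)" using eq_norm_if_Re_rc_embed[of "f x"] f(3,4) by auto
  moreover have "f z = 0"
  proof (rule eq_0_if_Re_rc_embed_mult)
    fix c
    have "u (smul c z) = 0"
      by (rule u(3)) (auto simp: G_def intro!: range_eqI[of _ _ "(0, c)"])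
    then show "Re (rc_embed (c * f z)) = 0" by (simp add: f(4) flip: f(2))
  qed
  ultimately show "\<exists>f. supporting_functional smul x f \<and> f z = 0"
    using supporting_functionalI[OF assms f(1-3)] by blast
next
  assume "\<exists>f. supporting_functional smul x f \<and> f z = 0"
  then obtain f where f: "supporting_functional smul x f" "f z = 0" by blast
  show "bj_orthogonal smul x z"
    unfolding bj_orthogonal_def
  proof
    fix c
    have "f (x + smul c z) = of_real (norm x)" by (simp add: supporting_functionalD[OF f(1)] f(2))
    then show "norm x \<le> norm (x + smul c z)"
      using supporting_functionalD(3)[OF f(1), of "x + smul c z"] by simp
  qed
qed

lemma ex_supporting_functional:
  assumes "x \<noteq> 0"
  obtains f where "supporting_functional smul x f"
proof -
  have "bj_orthogonal smul x 0" by (simp add: bj_orthogonal_def)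
  then show thesis using that bj_orthogonal_iff_supporting_functional[OF assms] by blast
qed

lemma supporting_functional_eqI:
  assumes "supporting_functional smul x f" "supporting_functional smul x g"
    "\<And>z. Re (rc_embed (f z)) = Re (rc_embed (g z))"
  shows "f = g"
proof
  fix z
  have "f z - g z = 0"
  proof (rule eq_0_if_Re_rc_embed_mult)
    fix c
    have "c * (f z - g z) = f (smul c z) - g (smul c z)"
      by (simp add: supporting_functionalD[OF assms(1)] supporting_functionalD[OF assms(2)]
        right_diff_distrib)
    then show "Re (rc_embed (c * (f z - g z))) = 0" using assms(3) by (simp add: rc_embed_diff)
  qed
  then show "f z = g z" by simp
qed

end

subsection \<open>Existence of smooth vectors\<close>

text \<open>The first-order condition in algebraic form: for small \<open>t\<close> of the sign of
  \<open>p\<close>, the linear term would beat the quadratic one. It replaces differentiating the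
  norm.\<close>

lemma eq_0_if_linear_le_square:
  fixes p q :: real
  assumes "\<And>t. t * p \<le> t\<^sup>2 * q"
  shows "p = 0"
proof (rule ccontr)
  assume "p \<noteq> 0"
  define t where "t = p / (\<bar>q\<bar> + 1)"
  have pt: "p = t * (\<bar>q\<bar> + 1)" by (simp add: t_def)
  have "t \<noteq> 0" using \<open>p \<noteq> 0\<close> by (simp add: t_def)
  then have "t\<^sup>2 > 0" by simp
  have "t\<^sup>2 * (\<bar>q\<bar> + 1) \<le> t\<^sup>2 * q" using assms[of t] by (simp add: pt power2_eq_square mult.assoc)
  then have "\<bar>q\<bar> + 1 \<le> q" using \<open>t\<^sup>2 > 0\<close> by (simp only: mult_le_cancel_left_pos)
  then show False by linarith
qed

text \<open>Gaussian elimination: each equation with a nonzero coefficient removes one unknown, and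
  at least one unknown remains free.\<close>

lemma ex_nontrivial_solution:
  fixes a :: "'i \<Rightarrow> 'j \<Rightarrow> 'f::field"
  assumes "finite I" "finite J" "card I < card J"
  shows "\<exists>c. (\<exists>j\<in>J. c j \<noteq> 0) \<and> (\<forall>i\<in>I. (\<Sum>j\<in>J. a i j * c j) = 0)"
  using assms
proof (induction I arbitrary: J a rule: finite_induct)
  case empty
  then have "J \<noteq> {}" by auto
  then show ?case by (intro exI[of _ "\<lambda>_. 1"]) auto
next
  case (insert i I)
  show ?case
  proof (cases "\<forall>j\<in>J. a i j = 0")
    case True
    obtain c where "\<exists>j\<in>J. c j \<noteq> 0" "\<forall>k\<in>I. (\<Sum>j\<in>J. a k j * c j) = 0"
      using insert.IH[of J a] insert.prems insert.hyps by auto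
    then show ?thesis using True by (intro exI[of _ c]) auto
  next
    case False
    then obtain m where m: "m \<in> J" "a i m \<noteq> 0" by blast
    \<comment> \<open>The coefficients after the unknown \<open>m\<close> has been eliminated by
      means of equation \<open>i\<close>; row \<open>i\<close> itself becomes 0.\<close>
    define a' where "a' k j = a k j - a i j * a k m / a i m" for k j
    have "card I < card (J - {m})"
      using insert.prems insert.hyps m(1) by simp
    then obtain c where c: "\<exists>j\<in>J - {m}. c j \<noteq> 0" "\<forall>k\<in>I. (\<Sum>j\<in>J - {m}. a' k j * c j) = 0"
      using insert.IH[of "J - {m}" a'] insert.prems(1) by auto
    \<comment> \<open>The eliminated unknown is restored so that equation \<open>i\<close>
      holds.\<close>
    define d where "d = c(m := - (\<Sum>j\<in>J - {m}. a i j * c j) / a i m)"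
    have split: "(\<Sum>j\<in>J. a k j * d j) =
        a k m * d m + (\<Sum>j\<in>J - {m}. a k j * c j)" for k
      using insert.prems(1) m(1) by (subst sum.remove[of _ m]) (auto simp: d_def intro!: sum.cong)
    have "(\<Sum>j\<in>J. a k j * d j) = (\<Sum>j\<in>J - {m}. a' k j * c j)" for k
    proof -
      have "a' k j * c j = a k j * c j - a k m / a i m * (a i j * c j)" for j
        by (simp add: a'_def left_diff_distrib)
      then have "(\<Sum>j\<in>J - {m}. a' k j * c j) =
          (\<Sum>j\<in>J - {m}. a k j * c j) - a k m / a i m * (\<Sum>j\<in>J - {m}. a i j * c j)"
        by (simp only: sum_subtractf sum_distrib_left)
      then show ?thesis unfolding split by (simp add: d_def)
    qed
    moreover have "(\<Sum>j\<in>J - {m}. a' i j * c j) = 0" using m(2) by (simp add: a'_def)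
    ultimately have "\<forall>k\<in>insert i I. (\<Sum>j\<in>J. a k j * d j) = 0" using c(2) by simp
    moreover have "\<exists>j\<in>J. d j \<noteq> 0" using c(1) by (auto simp: d_def)
    ultimately show ?thesis by blast
  qed
qed

context normed_space_over
begin

lemma continuous_on_combination:
  "continuous_on UNIV (\<lambda>c :: 'i \<Rightarrow> 'f. \<Sum>i\<in>I. smul (c i) (v i))"
proof (rule continuous_on_sum)
  fix i
  have "bounded_linear (\<lambda>a. smul a (v i))"
    by (rule bounded_linear_intro[of _ "norm (v i)"])
      (auto simp: scale_left_distrib norm_smul scaleR_conv_of_real simp flip: smul_of_real)
  moreover have "continuous_on UNIV (\<lambda>c :: 'i \<Rightarrow> 'f. c i)" by simp
  ultimately show "continuous_on UNIV (\<lambda>c. smul (c i) (v i))"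
    by (rule bounded_linear.continuous_on)
qed

text \<open>Take \<open>x = \<Sum>i\<in>I. c\<^sub>i v\<^sub>i\<close> of maximal norm \<open>N\<close> subject to \<open>\<parallel>c\<parallel>\<^sub>2 \<le> 1\<close>. The pulled back norm is at
  most \<open>N \<parallel>\<cdot>\<parallel>\<^sub>2\<close>, with equality at \<open>c\<close>, so it inherits smoothness at \<open>c\<close> from the Hilbert norm.\<close>

lemma ex_smooth_functional_neq_0:
  fixes v :: "'i \<Rightarrow> 'a"
  assumes fin: "finite I" and "m \<in> I"
    and spanning: "\<And>z. \<exists>c. z = (\<Sum>i\<in>I. smul (c i) (v i))"
    and small: "(\<Sum>i\<in>I - {m}. norm (v i)) < norm (v m)"
  obtains x f where "smooth_vector smul x" "supporting_functional smul x f" "f (v m) \<noteq> 0"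
proof -
  define \<Psi> where "\<Psi> c = (\<Sum>i\<in>I. smul (c i) (v i))" for c
  define Q where "Q c = (\<Sum>i\<in>I. (norm (c i))\<^sup>2)" for c :: "'i \<Rightarrow> 'f"
  define K where "K = {c :: 'i \<Rightarrow> 'f. (\<forall>i. i \<notin> I \<longrightarrow> c i = 0) \<and> Q c \<le> 1}"
  have "compact K" unfolding K_def Q_def using fin by (rule compact_l2_ball)
  have cont: "continuous_on K (\<lambda>c. norm (\<Psi> c))"
    unfolding \<Psi>_def
    by (intro continuous_on_norm continuous_on_subset[OF continuous_on_combination]) simp
  define \<delta> :: "'f \<Rightarrow> 'i \<Rightarrow> 'f" where "\<delta> s i = (if i = m then s else 0)" for s i
  have \<Psi>_\<delta>: "\<Psi> (\<delta> s) = smul s (v m)" for s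
    unfolding \<Psi>_def using fin \<open>m \<in> I\<close>
    by (subst sum.remove[of _ m]) (auto simp: \<delta>_def intro!: sum.neutral)
  have Q_\<delta>: "Q (\<delta> s) = (norm s)\<^sup>2" for s
    unfolding Q_def using fin \<open>m \<in> I\<close>
    by (subst sum.remove[of _ m]) (auto simp: \<delta>_def intro!: sum.neutral)
  have \<delta>K: "\<delta> 1 \<in> K" using \<open>m \<in> I\<close> Q_\<delta>[of 1] by (auto simp: K_def \<delta>_def)
  obtain c where c: "c \<in> K" and max: "\<And>d. d \<in> K \<Longrightarrow> norm (\<Psi> d) \<le> norm (\<Psi> c)"
    using continuous_attains_sup[OF \<open>compact K\<close> _ cont] \<delta>K by blast
  define x where "x = \<Psi> c"
  define N where "N = norm x"
  have vN: "norm (v m) \<le> N" using max[OF \<delta>K] by (simp add: N_def x_def \<Psi>_\<delta>)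
  moreover have "0 \<le> (\<Sum>i\<in>I - {m}. norm (v i))" by (simp add: sum_nonneg)
  ultimately have "N > 0" using small by linarith
  then have "x \<noteq> 0" by (auto simp: N_def)
  \<comment> \<open>By homogeneity: \<open>d\<close> is divided by its l2 norm and cut off outside
    \<open>I\<close>, which brings it into \<open>K\<close>, where the maximum is
    \<open>N\<close>.\<close>
  have bound: "(norm (\<Psi> d))\<^sup>2 \<le> N\<^sup>2 * Q d" for d
  proof (cases "Q d = 0")
    case True
    then have "d i = 0" if "i \<in> I" for i
      using that fin by (simp add: Q_def sum_nonneg_eq_0_iff)
    then have "\<Psi> d = 0" by (simp add: \<Psi>_def)
    then show ?thesis using True by simp
  next
    case False
    define r where "r = sqrt (Q d)"
    have "Q d \<ge> 0" by (simp add: Q_def sum_nonneg)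
    then have r: "r > 0" "r\<^sup>2 = Q d" using False by (auto simp: r_def)
    define e where "e i = (if i \<in> I then of_real (1 / r) * d i else 0)" for i
    have "Q e = (\<Sum>i\<in>I. (norm (d i))\<^sup>2 / r\<^sup>2)"
      unfolding Q_def by (rule sum.cong) (auto simp: e_def norm_mult power_divide norm_divide)
    also have "\<dots> = 1" using r False by (simp add: Q_def flip: sum_divide_distrib)
    finally have "e \<in> K" by (auto simp: K_def e_def)
    have "\<Psi> e = smul (of_real (1 / r)) (\<Psi> d)"
      unfolding \<Psi>_def scale_sum_right by (rule sum.cong) (auto simp: e_def)
    then have "norm (\<Psi> d) / r \<le> N"
      using max[OF \<open>e \<in> K\<close>] r(1) by (simp add: norm_smul norm_divide N_def x_def)
    then have "norm (\<Psi> d) \<le> N * r" using r(1) by (simp add: divide_le_eq)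
    then have "(norm (\<Psi> d))\<^sup>2 \<le> (N * r)\<^sup>2" by (intro power_mono) auto
    then show ?thesis by (simp add: power_mult_distrib r(2))
  qed
  \<comment> \<open>Evaluating \<open>f\<close> at \<open>c + t d\<close> gives
    \<open>(N + t * a)\<^sup>2 \<le> N\<^sup>2 * Q e\<close>. The constant terms cancel since
    \<open>Q c \<le> 1\<close>, and comparing first-order terms yields \<open>a = N * b\<close>. The
    right-hand side does not mention \<open>f\<close>, whence uniqueness.\<close>
  have key: "Re (rc_embed (f (\<Psi> d))) = N * (\<Sum>i\<in>I. rc_embed (c i) \<bullet> rc_embed (d i))"
    if f: "supporting_functional smul x f" for f d
  proof -
    define a where "a = Re (rc_embed (f (\<Psi> d)))"
    define b where "b = (\<Sum>i\<in>I. rc_embed (c i) \<bullet> rc_embed (d i))"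
    have "t * (2 * N * (a - N * b)) \<le> t\<^sup>2 * (N\<^sup>2 * Q d - a\<^sup>2)" for t
    proof -
      define e where "e i = c i + of_real t * d i" for i
      have "\<Psi> e = x + smul (of_real t) (\<Psi> d)"
        by (simp add: \<Psi>_def e_def x_def scale_left_distrib sum.distrib scale_sum_right)
      then have "Re (rc_embed (f (\<Psi> e))) = N + t * a"
        by (simp add: supporting_functionalD[OF f] rc_embed_add Re_rc_embed_of_real_mult
          rc_embed_of_real a_def N_def)
      then have "\<bar>N + t * a\<bar> \<le> norm (\<Psi> e)"
        by (metis abs_Re_le_cmod norm_rc_embed order_trans supporting_functionalD(3)[OF f])
      then have "(N + t * a)\<^sup>2 \<le> N\<^sup>2 * Q e"
        using power_mono[of "\<bar>N + t * a\<bar>" "norm (\<Psi> e)" 2] bound[of e] by simp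
      also have "Q e = Q c + 2 * t * b + t\<^sup>2 * Q d"
      proof -
        have "(norm (e i))\<^sup>2 =
            (norm (c i))\<^sup>2 + 2 * t * (rc_embed (c i) \<bullet> rc_embed (d i)) + t\<^sup>2 * (norm (d i))\<^sup>2" for i
        proof -
          have "rc_embed (e i) = rc_embed (c i) + t *\<^sub>R rc_embed (d i)"
            by (simp add: e_def rc_embed_add rc_embed_mult rc_embed_of_real scaleR_conv_of_real)
          moreover have "(norm a)\<^sup>2 = rc_embed a \<bullet> rc_embed a" for a :: 'f
            by (metis norm_rc_embed power2_norm_eq_inner)
          ultimately show ?thesis
            by (simp add: inner_add inner_commute power2_eq_square algebra_simps)
        qed
        then show ?thesis by (simp add: Q_def b_def sum.distrib sum_distrib_left)
      qed
      also have "N\<^sup>2 * (Q c + 2 * t * b + t\<^sup>2 * Q d) \<le> N\<^sup>2 * (1 + 2 * t * b + t\<^sup>2 * Q d)"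
        using c by (intro mult_left_mono) (auto simp: K_def)
      finally show ?thesis by (simp add: power2_eq_square algebra_simps)
    qed
    then have "2 * N * (a - N * b) = 0" by (rule eq_0_if_linear_le_square)
    then show ?thesis using \<open>N > 0\<close> by (simp add: a_def b_def)
  qed
  obtain f where f: "supporting_functional smul x f"
    using ex_supporting_functional[OF \<open>x \<noteq> 0\<close>] .
  have "smooth_vector smul x"
    unfolding smooth_vector_def
  proof (intro conjI ex1I)
    show "x \<noteq> 0" by fact
    show "supporting_functional smul x f" by fact
    fix g assume g: "supporting_functional smul x g"
    show "g = f"
    proof (rule supporting_functional_eqI[OF g f])
      fix z
      obtain d where "z = \<Psi> d" using spanning unfolding \<Psi>_def by blast
      then show "Re (rc_embed (g z)) = Re (rc_embed (f z))" using key[OF g] key[OF f] by simp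
    qed
  qed
  \<comment> \<open>Otherwise the formula for \<open>f\<close>, at the vector supported in
    \<open>m\<close>, gives \<open>c m = 0\<close>. Then \<open>x\<close> combines the other vectors
    with coefficients of modulus at most 1, so by \<open>small\<close> it is shorter than
    \<open>v m\<close>, against maximality.\<close>
  moreover have "f (v m) \<noteq> 0"
  proof
    assume 0: "f (v m) = 0"
    have "N * (\<Sum>i\<in>I. rc_embed (c i) \<bullet> rc_embed (\<delta> (c m) i)) = 0"
      using key[OF f, of "\<delta> (c m)"] 0 by (simp add: \<Psi>_\<delta> supporting_functionalD[OF f] rc_embed_0)
    moreover have "(\<Sum>i\<in>I. rc_embed (c i) \<bullet> rc_embed (\<delta> (c m) i)) = rc_embed (c m) \<bullet> rc_embed (c m)"
      using fin \<open>m \<in> I\<close>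
      by (subst sum.remove[of _ m]) (auto simp: \<delta>_def rc_embed_0 intro!: sum.neutral)
    ultimately have "c m = 0"
      using \<open>N > 0\<close> by (simp add: norm_rc_embed flip: power2_norm_eq_inner)
    have "norm (c i) \<le> 1" if "i \<in> I" for i
    proof -
      have "(norm (c i))\<^sup>2 \<le> 1"
        using member_le_sum[OF that, of "\<lambda>i. (norm (c i))\<^sup>2"] c fin by (auto simp: K_def Q_def)
      then show ?thesis by (simp add: power_le_one_iff abs_square_le_1)
    qed
    have "x = (\<Sum>i\<in>I - {m}. smul (c i) (v i))"
      unfolding x_def \<Psi>_def using fin \<open>m \<in> I\<close> \<open>c m = 0\<close> by (subst sum.remove[of _ m]) auto
    also have "norm \<dots> \<le> (\<Sum>i\<in>I - {m}. norm (v i))"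
      using norm_smul_le[OF \<open>\<And>i. i \<in> I \<Longrightarrow> norm (c i) \<le> 1\<close>] by (intro sum_norm_le) auto
    finally show False using small vN by (simp add: N_def)
  qed
  ultimately show thesis using that f by blast
qed

text \<open>A finite spanning set is shrunk until \<open>y\<close> outweighs all the other
  generators together; the preceding lemma with \<open>m = y\<close> then applies.\<close>

lemma ex_smooth_not_orthogonal:
  assumes "finite_dimensional smul" "y \<noteq> 0"
  obtains x where "smooth_vector smul x" "\<not> bj_orthogonal smul x y"
proof -
  obtain S where S: "finite S" "span S = UNIV" using assms(1) by (auto simp: finite_dimensional_def)
  \<comment> \<open>The summand 1 keeps the denominator positive and makes the inequality in
    \<open>small\<close> strict.\<close>
  define \<delta> where "\<delta> = norm y / (1 + (\<Sum>b\<in>S. norm b))"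
  have s: "(\<Sum>b\<in>S. norm b) \<ge> 0" by (simp add: sum_nonneg)
  then have "\<delta> > 0" using assms(2) by (auto simp: \<delta>_def intro!: divide_pos_pos)
  define v where "v b = (if b = y then y else smul (of_real \<delta>) b)" for b
  have small: "(\<Sum>b\<in>insert y S - {y}. norm (v b)) < norm (v y)"
  proof -
    have "(\<Sum>b\<in>insert y S - {y}. norm (v b)) = (\<Sum>b\<in>S - {y}. \<delta> * norm b)"
      using \<open>\<delta> > 0\<close> by (intro sum.cong) (auto simp: v_def norm_smul)
    also have "\<dots> \<le> (\<Sum>b\<in>S. \<delta> * norm b)"
      using S(1) \<open>\<delta> > 0\<close> by (intro sum_mono2) auto
    also have "\<dots> = \<delta> * (\<Sum>b\<in>S. norm b)" by (simp add: sum_distrib_left)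
    also have "\<dots> < \<delta> * (1 + (\<Sum>b\<in>S. norm b))" using \<open>\<delta> > 0\<close> by simp
    also have "\<dots> = norm y" using s by (simp add: \<delta>_def)
    finally show ?thesis by (simp add: v_def)
  qed
  have "\<exists>c. z = (\<Sum>b\<in>insert y S. smul (c b) (v b))" for z
  proof -
    have "z \<in> range (\<lambda>u. \<Sum>b\<in>S. smul (u b) b)" using S span_finite[OF S(1)] by simp
    then obtain u where z: "z = (\<Sum>b\<in>S. smul (u b) b)" by (rule imageE)
    \<comment> \<open>The coefficients are rescaled to undo the shrinking, except at
      \<open>y\<close>, which keeps its size. If \<open>y\<close> lies outside \<open>S\<close>, it
      gets coefficient 0.\<close>
    define c where "c b = (if b \<in> S then if b = y then u b else u b / of_real \<delta> else 0)" for b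
    have "(\<Sum>b\<in>insert y S. smul (c b) (v b)) = (\<Sum>b\<in>S. smul (c b) (v b))"
      using S(1) by (intro sum.mono_neutral_right) (auto simp: c_def)
    also have "\<dots> = z"
      unfolding z using \<open>\<delta> > 0\<close> by (intro sum.cong) (auto simp: c_def v_def)
    finally show ?thesis by (intro exI[of _ c]) (rule sym)
  qed
  then obtain x f where x: "smooth_vector smul x" "supporting_functional smul x f" "f (v y) \<noteq> 0"
    using ex_smooth_functional_neq_0[of "insert y S" y v] small S(1) by blast
  have "x \<noteq> 0" "\<exists>!g. supporting_functional smul x g"
    using x(1) by (simp_all add: smooth_vector_def)
  moreover have "f y \<noteq> 0" using x(3) by (simp add: v_def)
  ultimately have "\<not> bj_orthogonal smul x y"
    using x(2) bj_orthogonal_iff_supporting_functional[of x y] by metis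
  then show thesis using that x(1) by blast
qed

section \<open>Common zeros of few functionals\<close>

lemma ex_independent_card:
  assumes "\<not> finite_dimensional smul"
  shows "\<exists>B. finite B \<and> independent B \<and> card B = k"
proof (induction k)
  case 0 show ?case by (intro exI[of _ "{}"]) (simp add: independent_empty)
next
  case (Suc k)
  then obtain B where B: "finite B" "independent B" "card B = k" by blast
  then obtain a where "a \<notin> span B" using assms by (auto simp: finite_dimensional_def)
  then have "independent (insert a B)" "a \<notin> B"
    using independent_insertI[OF _ B(2)] span_base by blast+
  then show ?case using B by (intro exI[of _ "insert a B"]) simp
qed

text \<open>With more independent vectors than functionals, a zero among their combinations solves a
  homogeneous system with more unknowns than equations. The bound on \<open>card I\<close> is
  conditional because \<open>dim\<close> is 0 in infinite dimension, where independent sets of every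
  finite size exist.\<close>

lemma ex_common_zero:
  assumes "finite I" and I: "finite_dimensional smul \<Longrightarrow> card I < dim UNIV"
    and f: "\<And>i. i \<in> I \<Longrightarrow> supporting_functional smul (x i) (f i)"
  obtains z where "z \<noteq> 0" "\<And>i. i \<in> I \<Longrightarrow> f i z = 0"
proof -
  obtain B where B: "finite B" "independent B" "card I < card B"
  proof (cases "finite_dimensional smul")
    case True
    then obtain S where S: "finite S" "span S = UNIV" by (auto simp: finite_dimensional_def)
    obtain B where "B \<subseteq> UNIV" "independent B" "UNIV \<subseteq> span B" "card B = dim UNIV"
      by (rule basis_exists)
    moreover have "finite B" using independent_span_bound[OF S(1) \<open>independent B\<close>] S(2) by simp
    ultimately show ?thesis using that I[OF True] by simp
  next
    case False
    then show ?thesis using ex_independent_card[of "Suc (card I)"] that by auto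
  qed
  obtain c where c: "\<exists>b\<in>B. c b \<noteq> 0" "\<forall>i\<in>I. (\<Sum>b\<in>B. f i b * c b) = 0"
    using ex_nontrivial_solution[OF \<open>finite I\<close> B(1,3), of f] by blast
  show thesis
  proof (rule that)
    show "(\<Sum>b\<in>B. smul (c b) b) \<noteq> 0"
      using B(1,2) c(1) by (auto simp: dependent_finite)
    show "f i (\<Sum>b\<in>B. smul (c b) b) = 0" if "i \<in> I" for i
      using c(2) that by (simp add: supporting_functionalD[OF f[OF that]] mult.commute)
  qed
qed

end

subsection \<open>Frames and domination in digraphs\<close>

definition common_out :: "'v pair_pre_digraph \<Rightarrow> 'v set \<Rightarrow> 'v set" where
  "common_out G \<Omega> = pverts G \<inter> (\<Inter>v\<in>\<Omega>. out_perp G v)"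

text \<open>The graph version of a basis of the dual space: the members of \<open>\<Omega>\<close>
  stand for hyperplanes in general position, the vertices \<open>e\<close> for the lines of the dual
  basis.\<close>

definition frame :: "'v pair_pre_digraph \<Rightarrow> nat \<Rightarrow> 'v set \<Rightarrow> bool" where
  "frame G n \<Omega> \<longleftrightarrow> finite \<Omega> \<and> \<Omega> \<subseteq> pverts G \<and> card \<Omega> = n \<and> common_out G \<Omega> = {} \<and>
     (\<forall>v\<in>\<Omega>. \<exists>e. common_out G (\<Omega> - {v}) = {e})"

definition out_dominating :: "'v pair_pre_digraph \<Rightarrow> 'v \<Rightarrow> 'v set" where
  "out_dominating G v = {w \<in> pverts G. out_perp G v \<subseteq> out_perp G w}"

text \<open>Maximality is only among sets of the same form, so that it is visible in the digraph;
  \<open>maximal_faces_eq_max_dominating\<close> compares it with maximality among faces.\<close>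

definition max_dominating :: "'v pair_pre_digraph \<Rightarrow> 'v set set" where
  "max_dominating G = {out_dominating G v | v. v \<in> pverts G \<and>
     (\<forall>w\<in>pverts G. \<not> out_dominating G v \<subset> out_dominating G w)}"

text \<open>Lets every transfer result be proved as an inclusion or inequality in one direction, the
  other one coming from the inverse.\<close>

lemma digraph_isomorphism_the_inv_into:
  assumes "digraph_isomorphism G H \<phi>"
  shows "digraph_isomorphism H G (the_inv_into (pverts G) \<phi>)"
proof -
  have bij: "bij_betw \<phi> (pverts G) (pverts H)" using assms by (simp add: digraph_isomorphism_def)
  then have inj: "inj_on \<phi> (pverts G)" and im: "\<phi> ` pverts G = pverts H"
    by (auto simp: bij_betw_def)
  define \<psi> where "\<psi> = the_inv_into (pverts G) \<phi>"
  have \<phi>\<psi>: "\<phi> (\<psi> u) = u" if "u \<in> pverts H" for u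
    using f_the_inv_into_f[OF inj] im that by (simp add: \<psi>_def)
  have bij': "bij_betw \<psi> (pverts H) (pverts G)"
    unfolding \<psi>_def by (rule bij_betw_the_inv_into[OF bij])
  have "(u, v) \<in> parcs H \<longleftrightarrow> (\<psi> u, \<psi> v) \<in> parcs G" if "u \<in> pverts H" "v \<in> pverts H" for u v
  proof -
    have "\<psi> u \<in> pverts G" "\<psi> v \<in> pverts G" using that bij' by (auto dest: bij_betwE)
    then have "(\<psi> u, \<psi> v) \<in> parcs G \<longleftrightarrow> (\<phi> (\<psi> u), \<phi> (\<psi> v)) \<in> parcs H"
      using assms unfolding digraph_isomorphism_def by blast
    then show ?thesis using that by (simp add: \<phi>\<psi>)
  qed
  then show ?thesis using bij' by (simp add: digraph_isomorphism_def \<psi>_def)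
qed

section \<open>Invariance of frames and dominating sets under isomorphisms\<close>

context
  fixes G :: "'u pair_pre_digraph" and H :: "'v pair_pre_digraph" and \<phi>
  assumes iso: "digraph_isomorphism G H \<phi>"
begin

lemma iso_bij_betw: "bij_betw \<phi> (pverts G) (pverts H)"
  using iso by (simp add: digraph_isomorphism_def)

lemma iso_inj_on: "inj_on \<phi> (pverts G)"
  using iso_bij_betw by (simp add: bij_betw_def)

lemma iso_image_pverts: "\<phi> ` pverts G = pverts H"
  using iso_bij_betw by (simp add: bij_betw_def)

lemma iso_out_perp:
  assumes "v \<in> pverts G"
  shows "out_perp H (\<phi> v) = \<phi> ` out_perp G v"
  using iso assms unfolding out_perp_def digraph_isomorphism_def
  by (auto simp: iso_image_pverts[symmetric])

lemma iso_common_out: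
  assumes "\<Omega> \<subseteq> pverts G"
  shows "common_out H (\<phi> ` \<Omega>) = \<phi> ` common_out G \<Omega>"
proof -
  have "\<phi> w \<in> out_perp H (\<phi> v) \<longleftrightarrow> w \<in> out_perp G v" if "v \<in> pverts G" "w \<in> pverts G" for v w
    using that iso by (auto simp: out_perp_def digraph_isomorphism_def bij_betw_apply)
  then show ?thesis
    using assms by (auto simp: common_out_def iso_image_pverts[symmetric] subset_iff)
qed

lemma iso_frame:
  assumes "frame G n \<Omega>"
  shows "frame H n (\<phi> ` \<Omega>)"
proof -
  have \<Omega>: "finite \<Omega>" "\<Omega> \<subseteq> pverts G" "card \<Omega> = n" "common_out G \<Omega> = {}"
    and e: "\<And>v. v \<in> \<Omega> \<Longrightarrow> \<exists>e. common_out G (\<Omega> - {v}) = {e}"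
    using assms by (auto simp: frame_def)
  have inj: "inj_on \<phi> \<Omega>" using iso_inj_on \<Omega>(2) by (rule inj_on_subset)
  have "\<exists>e. common_out H (\<phi> ` \<Omega> - {\<phi> v}) = {e}" if "v \<in> \<Omega>" for v
  proof -
    have "\<phi> ` \<Omega> - {\<phi> v} = \<phi> ` (\<Omega> - {v})" using inj that by (auto simp: inj_on_def)
    moreover have "common_out H (\<phi> ` (\<Omega> - {v})) = \<phi> ` common_out G (\<Omega> - {v})"
      using \<Omega>(2) by (intro iso_common_out) auto
    ultimately show ?thesis using e[OF that] by auto
  qed
  moreover have "\<phi> ` \<Omega> \<subseteq> pverts H" using \<Omega>(2) iso_image_pverts by blast
  ultimately show ?thesis
    using \<Omega> inj by (simp add: frame_def card_image iso_common_out)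
qed

lemma iso_out_dominating:
  assumes "v \<in> pverts G"
  shows "out_dominating H (\<phi> v) = \<phi> ` out_dominating G v"
proof -
  have "out_perp G u \<subseteq> pverts G" for u by (auto simp: out_perp_def)
  then have "out_perp H (\<phi> v) \<subseteq> out_perp H (\<phi> w) \<longleftrightarrow> out_perp G v \<subseteq> out_perp G w"
    if "w \<in> pverts G" for w
    using that assms by (simp add: iso_out_perp inj_on_image_subset_iff[OF iso_inj_on])
  then show ?thesis by (auto simp: out_dominating_def iso_image_pverts[symmetric])
qed

lemma iso_max_dominating:
  assumes "S \<in> max_dominating G"
  shows "\<phi> ` S \<in> max_dominating H"
proof -
  obtain v where v: "v \<in> pverts G" "S = out_dominating G v"
    "\<And>w. w \<in> pverts G \<Longrightarrow> \<not> out_dominating G v \<subset> out_dominating G w"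
    using assms by (auto simp: max_dominating_def)
  have sub: "out_dominating G u \<subseteq> pverts G" for u by (auto simp: out_dominating_def)
  have "\<not> out_dominating H (\<phi> v) \<subset> out_dominating H (\<phi> w)" if "w \<in> pverts G" for w
    using v(1) v(3)[OF that] that sub
    by (simp add: iso_out_dominating psubset_eq inj_on_image_subset_iff[OF iso_inj_on]
      inj_on_image_eq_iff[OF iso_inj_on])
  then have "\<forall>w\<in>pverts H. \<not> out_dominating H (\<phi> v) \<subset> out_dominating H w"
    by (simp flip: iso_image_pverts)
  moreover have "\<phi> v \<in> pverts H" using v(1) iso_image_pverts by blast
  ultimately show ?thesis
    unfolding max_dominating_def v(2) iso_out_dominating[OF v(1), symmetric] by blast
qed

end

subsection \<open>Smooth points of the orthodigraph\<close>

context normed_space_over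
begin

abbreviation "\<Gamma> \<equiv> orthodigraph smul"

lemma pverts_orthodigraph: "pverts \<Gamma> = proj_space smul"
  by (simp add: orthodigraph_def)

lemma mem_line: "x \<in> line smul x"
  unfolding line_def by (rule range_eqI[of _ _ 1]) simp

lemma line_smul:
  assumes "c \<noteq> 0"
  shows "line smul (smul c x) = line smul x"
proof -
  have "smul a x \<in> range (\<lambda>d. smul d (smul c x))" for a
    using assms by (intro range_eqI[of _ _ "a / c"]) simp
  then show ?thesis unfolding line_def by auto
qed

lemma line_eqE:
  assumes "line smul x = line smul y"
  obtains c where "x = smul c y"
  using mem_line[of x] assms by (auto simp: line_def)

lemma line_in_pverts: "x \<noteq> 0 \<Longrightarrow> line smul x \<in> pverts \<Gamma>"
  by (auto simp: pverts_orthodigraph proj_space_def)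

lemma pverts_cases:
  assumes "v \<in> pverts \<Gamma>"
  obtains x where "x \<noteq> 0" "v = line smul x"
  using assms by (auto simp: pverts_orthodigraph proj_space_def)

lemma line_in_out_perp_iff:
  assumes "x \<noteq> 0" "z \<noteq> 0"
  shows "line smul z \<in> out_perp \<Gamma> (line smul x) \<longleftrightarrow> bj_orthogonal smul x z"
  using orthodigraph_arc_iff[OF normed_space_over_axioms assms] assms line_in_pverts
  by (simp add: out_perp_def)

definition rep :: "'a set \<Rightarrow> 'a" where
  "rep v = (SOME x. x \<noteq> 0 \<and> line smul x = v)"

lemma rep:
  assumes "v \<in> pverts \<Gamma>"
  shows "rep v \<noteq> 0" "line smul (rep v) = v"
proof -
  have "\<exists>x. x \<noteq> 0 \<and> line smul x = v" using assms by (metis pverts_cases)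
  then have "rep v \<noteq> 0 \<and> line smul (rep v) = v" unfolding rep_def by (rule someI_ex)
  then show "rep v \<noteq> 0" "line smul (rep v) = v" by auto
qed

lemma line_in_out_perp_iff_functional:
  assumes "v \<in> pverts \<Gamma>" "z \<noteq> 0"
  shows "line smul z \<in> out_perp \<Gamma> v \<longleftrightarrow> (\<exists>f. supporting_functional smul (rep v) f \<and> f z = 0)"
  using line_in_out_perp_iff[OF rep(1)[OF assms(1)] assms(2)]
  by (simp add: rep[OF assms(1)] bj_orthogonal_iff_supporting_functional)

text \<open>One supporting functional per vertex suffices here. The converse fails for a fixed
  family \<open>f\<close>, as a vertex that is not smooth may reach \<open>z\<close> through another
  functional.\<close>

lemma line_in_common_outI:
  assumes "z \<noteq> 0" "\<Omega> \<subseteq> pverts \<Gamma>"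
    and "\<And>v. v \<in> \<Omega> \<Longrightarrow> supporting_functional smul (rep v) (f v)" "\<And>v. v \<in> \<Omega> \<Longrightarrow> f v z = 0"
  shows "line smul z \<in> common_out \<Gamma> \<Omega>"
  using assms line_in_pverts line_in_out_perp_iff_functional by (fastforce simp: common_out_def)

lemma ex_rep_functionals:
  assumes "\<Omega> \<subseteq> pverts \<Gamma>"
  obtains f where "\<And>v. v \<in> \<Omega> \<Longrightarrow> supporting_functional smul (rep v) (f v)"
proof -
  have "\<exists>f. supporting_functional smul (rep v) f" if "v \<in> \<Omega>" for v
    using ex_supporting_functional rep(1) assms that by (metis subsetD)
  then show thesis using that by metis
qed

lemma common_out_nonempty:
  assumes "finite \<Omega>" "\<Omega> \<subseteq> pverts \<Gamma>" "finite_dimensional smul \<Longrightarrow> card \<Omega> < dim UNIV"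
  shows "common_out \<Gamma> \<Omega> \<noteq> {}"
proof -
  obtain f where f: "\<And>v. v \<in> \<Omega> \<Longrightarrow> supporting_functional smul (rep v) (f v)"
    using ex_rep_functionals[OF assms(2)] by blast
  obtain z where "z \<noteq> 0" "\<And>v. v \<in> \<Omega> \<Longrightarrow> f v z = 0"
    using ex_common_zero[OF assms(1,3), where f = f and x = rep] f by blast
  then show ?thesis using line_in_common_outI[OF _ assms(2), of z f] f by blast
qed

text \<open>The contrapositive of \<open>common_out_nonempty\<close>. It is applied to a witness of
  finite \<open>digraph_dim\<close> and to the image of a frame under an isomorphism.\<close>

lemma finite_dimensional_if_common_out_empty:
  assumes "finite \<Omega>" "\<Omega> \<subseteq> pverts \<Gamma>" "common_out \<Gamma> \<Omega> = {}"
  shows "finite_dimensional smul" "dim UNIV \<le> card \<Omega>"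
  using common_out_nonempty[OF assms(1,2)] assms(3) by force+

text \<open>If \<open>\<Omega>\<close> is a frame with \<open>common_out \<Gamma> (\<Omega> - {v}) = {[e\<^sub>v]}\<close>, then the \<open>e\<^sub>v\<close> form a basis, and any
  functional supporting \<open>w \<in> \<Omega>\<close> vanishes at all of them but \<open>e\<^sub>w\<close>.\<close>

lemma smooth_if_in_frame:
  assumes fd: "finite_dimensional smul" and "frame \<Gamma> (dim UNIV) \<Omega>" and "w \<in> \<Omega>"
  shows "w \<in> smooth_points smul"
proof -
  have \<Omega>: "finite \<Omega>" "\<Omega> \<subseteq> pverts \<Gamma>" "card \<Omega> = dim UNIV" "common_out \<Gamma> \<Omega> = {}"
    and "\<And>v. v \<in> \<Omega> \<Longrightarrow> \<exists>E. common_out \<Gamma> (\<Omega> - {v}) = {E}"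
    using assms(2) by (auto simp: frame_def)
  then obtain E where E: "\<And>v. v \<in> \<Omega> \<Longrightarrow> common_out \<Gamma> (\<Omega> - {v}) = {E v}" by metis
  define e where "e v = rep (E v)" for v
  have "E v \<in> pverts \<Gamma>" if "v \<in> \<Omega>" for v using E[OF that] by (auto simp: common_out_def)
  then have e: "e v \<noteq> 0" "line smul (e v) = E v" if "v \<in> \<Omega>" for v
    using that rep by (auto simp: e_def)
  obtain h where h: "\<And>v. v \<in> \<Omega> \<Longrightarrow> supporting_functional smul (rep v) (h v)"
    using ex_rep_functionals[OF \<Omega>(2)] by blast
  have zero: "f (e v) = 0"
    if "u \<in> \<Omega>" "v \<in> \<Omega>" "v \<noteq> u" and f: "supporting_functional smul (rep u) f" for u v f
  proof -
    \<comment> \<open>The vertex \<open>E v\<close> does not depend on which functionals are chosen,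
      so the arbitrary \<open>f\<close> may replace the chosen one at \<open>u\<close>.\<close>
    define h' where "h' = h(u := f)"
    have h': "supporting_functional smul (rep x) (h' x)" if "x \<in> \<Omega> - {v}" for x
      using h f that by (auto simp: h'_def)
    have "card (\<Omega> - {v}) < dim UNIV"
      using \<Omega>(1,3) that(2) by (metis card_Diff1_less)
    then obtain z where z: "z \<noteq> 0" "\<And>x. x \<in> \<Omega> - {v} \<Longrightarrow> h' x z = 0"
      using ex_common_zero[of "\<Omega> - {v}" rep h'] h' \<Omega>(1) by blast
    have "line smul z \<in> common_out \<Gamma> (\<Omega> - {v})"
      using z h' \<Omega>(2) by (intro line_in_common_outI[of _ _ h']) auto
    then have "line smul (e v) = line smul z" using E e(2) that(2) by auto
    then obtain c where "e v = smul c z" by (rule line_eqE)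
    moreover have "f z = 0" using z(2)[of u] that by (simp add: h'_def)
    ultimately show ?thesis by (simp add: supporting_functionalD(2)[OF f])
  qed
  have nonzero: "f (e u) \<noteq> 0" if "u \<in> \<Omega>" and f: "supporting_functional smul (rep u) f" for u f
  proof
    assume "f (e u) = 0"
    then have "E u \<in> out_perp \<Gamma> u"
      using line_in_out_perp_iff_functional[of u "e u"] f e[OF that(1)] that(1) \<Omega>(2) by auto
    moreover have "E u \<in> common_out \<Gamma> (\<Omega> - {u})" using E[OF that(1)] by simp
    ultimately have "E u \<in> common_out \<Gamma> \<Omega>" by (auto simp: common_out_def)
    then show False using \<Omega>(4) by simp
  qed
  have w: "w \<in> pverts \<Gamma>" using \<Omega>(2) assms(3) by blast
  have uniq: "f = g"
    if f: "supporting_functional smul (rep w) f" and g: "supporting_functional smul (rep w) g" for f g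
  proof -
    define c where "c = f (e w) / g (e w)"
    have fg: "f z = c * g z" for z
    proof -
      \<comment> \<open>An interpolant: \<open>h v\<close> agrees on \<open>y\<close> and
        \<open>z\<close> for all \<open>v \<noteq> w\<close>, while everything supporting
        \<open>rep w\<close> kills \<open>y\<close>. Hence \<open>z - y\<close> is a multiple of
        \<open>e w\<close>, where \<open>f\<close> and \<open>g\<close> differ by the factor
        \<open>c\<close>.\<close>
      define y where "y = (\<Sum>u\<in>\<Omega> - {w}. smul (h u z / h u (e u)) (e u))"
      have f_y: "k y = 0" if k: "supporting_functional smul (rep w) k" for k
        unfolding y_def supporting_functionalD(2,7)[OF k]
        using zero[OF \<open>w \<in> \<Omega>\<close> _ _ k] by (intro sum.neutral) auto
      have h_y: "h v y = h v z" if v: "v \<in> \<Omega>" "v \<noteq> w" for v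
      proof -
        have "h v y = (\<Sum>u\<in>\<Omega> - {w}. h u z / h u (e u) * h v (e u))"
          by (simp add: y_def supporting_functionalD[OF h[OF v(1)]])
        also have "\<dots> = h v z / h v (e v) * h v (e v) +
            (\<Sum>u\<in>\<Omega> - {w} - {v}. h u z / h u (e u) * h v (e u))"
          using v \<Omega>(1) by (intro sum.remove) auto
        also have "(\<Sum>u\<in>\<Omega> - {w} - {v}. h u z / h u (e u) * h v (e u)) = 0"
          using zero[OF v(1) _ _ h[OF v(1)]] by (intro sum.neutral) auto
        finally show ?thesis using nonzero[OF v(1) h[OF v(1)]] by simp
      qed
      have "f (z - y) = c * g (z - y)"
      proof (cases "z - y = 0")
        case True
        then show ?thesis using supporting_functionalD(5)[OF f] supporting_functionalD(5)[OF g] by simp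
      next
        case False
        have "line smul (z - y) \<in> common_out \<Gamma> (\<Omega> - {w})"
          using False \<Omega>(2) h h_y
          by (intro line_in_common_outI[of _ _ h]) (auto simp: supporting_functionalD(6)[OF h])
        then have "line smul (z - y) = line smul (e w)" using E e(2) assms(3) by auto
        then obtain s where "z - y = smul s (e w)" by (rule line_eqE)
        then show ?thesis
          using nonzero[OF assms(3) g]
          by (simp add: c_def supporting_functionalD(2)[OF f] supporting_functionalD(2)[OF g])
      qed
      then show ?thesis
        by (simp add: supporting_functionalD(6)[OF f] supporting_functionalD(6)[OF g] f_y[OF f] f_y[OF g])
    qed
    have "c = 1"
      using fg[of "rep w"] rep(1)[OF w] supporting_functionalD(4)[OF f] supporting_functionalD(4)[OF g]
      by simp
    then show ?thesis using fg by (intro ext) simp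
  qed
  have "smooth_vector smul (rep w)"
    unfolding smooth_vector_def using uniq h[OF assms(3)] rep(1)[OF w] by blast
  then show ?thesis using rep(2)[OF w] by (auto simp: smooth_points_def)
qed

section \<open>Completing smooth points to frames\<close>

lemma smooth_points_subset: "smooth_points smul \<subseteq> pverts \<Gamma>"
  by (auto simp: smooth_points_def smooth_vector_def intro: line_in_pverts)

text \<open>Uniqueness of the supporting functional reduces the union of kernels to a single
  hyperplane.\<close>

lemma out_perp_smooth_point:
  assumes "v \<in> smooth_points smul"
  obtains x f where "x \<noteq> 0" "v = line smul x" "supporting_functional smul x f"
    "\<And>z. z \<noteq> 0 \<Longrightarrow> line smul z \<in> out_perp \<Gamma> v \<longleftrightarrow> f z = 0"
proof -
  obtain x where x: "v = line smul x" "x \<noteq> 0" "\<exists>!f. supporting_functional smul x f"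
    using assms by (auto simp: smooth_points_def smooth_vector_def)
  obtain f where f: "supporting_functional smul x f" using x(3) by blast
  have "bj_orthogonal smul x z \<longleftrightarrow> f z = 0" for z
    using x(3) f bj_orthogonal_iff_supporting_functional[OF x(2)] by metis
  then show thesis using that x(1,2) f line_in_out_perp_iff by blast
qed

text \<open>Greedy choice: as long as the functionals have a common zero
  \<open>y \<noteq> 0\<close>, a smooth point not orthogonal to \<open>y\<close> is added. A start
  with at most one point is automatically in general position; the empty start yields a frame, a
  singleton puts a given smooth point into one.\<close>

lemma ex_frame_extending:
  assumes fd: "finite_dimensional smul" and "\<Omega>\<^sub>0 \<subseteq> smooth_points smul" "finite \<Omega>\<^sub>0" "card \<Omega>\<^sub>0 \<le> 1"
  shows "\<exists>\<Omega>. \<Omega>\<^sub>0 \<subseteq> \<Omega> \<and> frame \<Gamma> (dim UNIV) \<Omega>"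
proof -
  define n where "n = dim UNIV"
  obtain S where S: "finite S" "span S = UNIV" using fd by (auto simp: finite_dimensional_def)
  obtain B where B: "B \<subseteq> UNIV" "independent B" "UNIV \<subseteq> span B" by (rule maximal_independent_subset)
  have "finite B" using independent_span_bound[OF S(1) B(2)] S(2) by simp
  interpret fdim: finite_dimensional_vector_space smul B
    by unfold_locales (use B \<open>finite B\<close> in auto)
  have "\<exists>p. fst p \<noteq> 0 \<and> v = line smul (fst p) \<and> supporting_functional smul (fst p) (snd p) \<and>
      (\<forall>z. z \<noteq> 0 \<longrightarrow> (line smul z \<in> out_perp \<Gamma> v \<longleftrightarrow> snd p z = 0))"
    if "v \<in> smooth_points smul" for v
    using out_perp_smooth_point[OF that] by (metis fst_conv snd_conv)
  then obtain p where p: "\<And>v. v \<in> smooth_points smul \<Longrightarrow> fst (p v) \<noteq> 0 \<and> v = line smul (fst (p v)) \<and>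
      supporting_functional smul (fst (p v)) (snd (p v)) \<and>
      (\<forall>z. z \<noteq> 0 \<longrightarrow> (line smul z \<in> out_perp \<Gamma> v \<longleftrightarrow> snd (p v) z = 0))"
    by metis
  define f where "f v = snd (p v)" for v
  define x where "x v = fst (p v)" for v
  have x: "x v \<noteq> 0" "line smul (x v) = v" and f: "supporting_functional smul (x v) (f v)"
    and perp: "\<And>z. z \<noteq> 0 \<Longrightarrow> line smul z \<in> out_perp \<Gamma> v \<longleftrightarrow> f v z = 0"
    if "v \<in> smooth_points smul" for v
    using p[OF that] by (auto simp: x_def f_def)
  define ann where "ann \<Omega> = {z. \<forall>v\<in>\<Omega>. f v z = 0}" for \<Omega>
  have subsp: "subspace (ann \<Omega>)" if "\<Omega> \<subseteq> smooth_points smul" for \<Omega>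
    unfolding subspace_def ann_def using that by (auto simp: supporting_functionalD[OF f] subset_iff)
  have dim_less: "dim (ann (insert v \<Omega>)) < dim (ann \<Omega>)"
    if "insert v \<Omega> \<subseteq> smooth_points smul" "y \<in> ann \<Omega>" "f v y \<noteq> 0" for v \<Omega> y
  proof -
    have "ann (insert v \<Omega>) \<subset> ann \<Omega>" using that(2,3) by (auto simp: ann_def)
    moreover have "span (ann (insert v \<Omega>)) = ann (insert v \<Omega>)" "span (ann \<Omega>) = ann \<Omega>"
      using subsp[OF that(1)] subsp[of \<Omega>] that(1) by (simp_all only: span_eq_iff insert_subset)
    ultimately show ?thesis by (metis fdim.dim_psubset)
  qed
  \<comment> \<open>The invariant is \<open>dim (ann \<Omega>) + card \<Omega> \<le> n\<close>: each
    new point raises the cardinality by one and lowers the dimension by at least one. At cardinality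
    \<open>n\<close> the annihilator is trivial.\<close>
  have ext: "\<exists>\<Omega>'. \<Omega> \<subseteq> \<Omega>' \<and> finite \<Omega>' \<and> \<Omega>' \<subseteq> smooth_points smul \<and> card \<Omega>' = n \<and> ann \<Omega>' \<subseteq> {0}"
    if "finite \<Omega>" "\<Omega> \<subseteq> smooth_points smul" "dim (ann \<Omega>) + card \<Omega> \<le> n" for \<Omega>
    using that
  proof (induction "n - card \<Omega>" arbitrary: \<Omega>)
    case 0
    then have "dim (ann \<Omega>) = 0" and card: "card \<Omega> = n" by linarith+
    from this(1) have "ann \<Omega> \<subseteq> {0}" by (simp only: fdim.dim_eq_0)
    then show ?case using 0 card by blast
  next
    case (Suc k)
    have "card \<Omega> < dim UNIV" using Suc.hyps(2) by (simp only: n_def)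
    then obtain y where y: "y \<noteq> 0" "\<And>v. v \<in> \<Omega> \<Longrightarrow> f v y = 0"
      using ex_common_zero[OF Suc.prems(1), of x f] f Suc.prems(2) by blast
    obtain u where u: "smooth_vector smul u" "\<not> bj_orthogonal smul u y"
      using ex_smooth_not_orthogonal[OF fd y(1)] .
    define v where "v = line smul u"
    have v: "v \<in> smooth_points smul" using u(1) by (auto simp: v_def smooth_points_def)
    have "line smul y \<notin> out_perp \<Gamma> v"
      using u y(1) line_in_out_perp_iff by (auto simp: v_def smooth_vector_def)
    then have fv: "f v y \<noteq> 0" using perp[OF v y(1)] by simp
    then have "v \<notin> \<Omega>" using y(2) by blast
    have sub: "insert v \<Omega> \<subseteq> smooth_points smul" using v Suc.prems(2) by simp
    have "y \<in> ann \<Omega>" using y(2) by (simp add: ann_def)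
    then have "dim (ann (insert v \<Omega>)) < dim (ann \<Omega>)" using dim_less[OF sub _ fv] by blast
    moreover have card: "card (insert v \<Omega>) = Suc (card \<Omega>)"
      using \<open>v \<notin> \<Omega>\<close> Suc.prems(1) by simp
    ultimately have "dim (ann (insert v \<Omega>)) + card (insert v \<Omega>) \<le> n" using Suc.prems(3) by linarith
    moreover have "k = n - card (insert v \<Omega>)" using Suc.hyps(2) card by linarith
    ultimately obtain \<Omega>' where "insert v \<Omega> \<subseteq> \<Omega>'" "finite \<Omega>'" "\<Omega>' \<subseteq> smooth_points smul" "card \<Omega>' = n"
      "ann \<Omega>' \<subseteq> {0}"
      using Suc.hyps(1)[of "insert v \<Omega>"] Suc.prems(1) sub by blast
    then show ?case by (intro exI[of _ \<Omega>']) auto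
  qed
  have "dim (ann \<Omega>\<^sub>0) + card \<Omega>\<^sub>0 \<le> n"
  proof (cases "\<Omega>\<^sub>0 = {}")
    case True
    then show ?thesis by (simp add: ann_def n_def)
  next
    case False
    then obtain v where v: "\<Omega>\<^sub>0 = {v}"
      using assms(3,4) by (metis One_nat_def card_1_singletonE card_gt_0_iff le_antisym Suc_leI)
    then have "v \<in> smooth_points smul" using assms(2) by simp
    then have "f v (x v) \<noteq> 0" using supporting_functionalD(4)[OF f] x by simp
    moreover have "x v \<in> ann {}" by (simp add: ann_def)
    ultimately have "dim (ann {v}) < dim (ann {})" using dim_less[of v "{}"] v assms(2) by blast
    moreover have "ann {} = UNIV" by (simp add: ann_def)
    ultimately show ?thesis by (simp only: v n_def card.empty card.insert) auto
  qed
  then obtain \<Omega> where \<Omega>: "\<Omega>\<^sub>0 \<subseteq> \<Omega>" "finite \<Omega>" "\<Omega> \<subseteq> smooth_points smul" "card \<Omega> = n" "ann \<Omega> \<subseteq> {0}"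
    using ext[OF assms(3,2)] by blast
  have \<Omega>V: "\<Omega> \<subseteq> pverts \<Gamma>" using \<Omega>(3) smooth_points_subset by blast
  have zero: "z = 0" if "\<And>v. v \<in> \<Omega> \<Longrightarrow> f v z = 0" for z using \<Omega>(5) that by (auto simp: ann_def)
  have vanish: "f v z = 0" if "line smul z \<in> common_out \<Gamma> \<Omega>'" "z \<noteq> 0" "v \<in> \<Omega>'" "\<Omega>' \<subseteq> \<Omega>" for v z \<Omega>'
    using that perp \<Omega>(3) by (fastforce simp: common_out_def)
  have "common_out \<Gamma> \<Omega> = {}"
  proof (rule ccontr)
    assume "common_out \<Gamma> \<Omega> \<noteq> {}"
    then obtain V where V: "V \<in> common_out \<Gamma> \<Omega>" by blast
    then have "V \<in> pverts \<Gamma>" by (simp add: common_out_def)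
    then obtain z where "z \<noteq> 0" "V = line smul z" by (rule pverts_cases)
    then show False using zero vanish V by blast
  qed
  moreover have "\<exists>e. common_out \<Gamma> (\<Omega> - {v}) = {e}" if "v \<in> \<Omega>" for v
  proof -
    have "card (\<Omega> - {v}) < dim UNIV" using \<Omega>(2,4) that unfolding n_def by (metis card_Diff1_less)
    then have "common_out \<Gamma> (\<Omega> - {v}) \<noteq> {}" using \<Omega>(2) \<Omega>V by (intro common_out_nonempty) auto
    moreover have "V = W" if VW: "V \<in> common_out \<Gamma> (\<Omega> - {v})" "W \<in> common_out \<Gamma> (\<Omega> - {v})" for V W
    proof -
      have "V \<in> pverts \<Gamma>" "W \<in> pverts \<Gamma>" using VW by (auto simp: common_out_def)
      then obtain y z where y: "y \<noteq> 0" "V = line smul y" and z: "z \<noteq> 0" "W = line smul z"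
        by (metis pverts_cases)
      have fy: "f u y = 0" and fz: "f u z = 0" if "u \<in> \<Omega>" "u \<noteq> v" for u
        using vanish[of _ "\<Omega> - {v}" u] VW y z that by auto
      have v0: "f v y \<noteq> 0" "f v z \<noteq> 0" using zero fy fz y(1) z(1) by metis+
      \<comment> \<open>Chosen so that \<open>y - smul c z\<close> is also killed by
        \<open>f v\<close>, the functional left out, and hence is 0.\<close>
      define c where "c = f v y / f v z"
      have "y - smul c z = 0"
      proof (rule zero)
        fix u assume "u \<in> \<Omega>"
        then have fu: "supporting_functional smul (x u) (f u)" using f \<Omega>(3) by blast
        have "f u (y - smul c z) = f u y - c * f u z" by (simp add: supporting_functionalD[OF fu])
        then show "f u (y - smul c z) = 0"
          using fy[OF \<open>u \<in> \<Omega>\<close>] fz[OF \<open>u \<in> \<Omega>\<close>] v0 by (cases "u = v") (auto simp: c_def)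
      qed
      then have "y = smul c z" by simp
      moreover have "c \<noteq> 0" using v0 by (simp add: c_def)
      ultimately show ?thesis using y z line_smul by simp
    qed
    ultimately show ?thesis by blast
  qed
  ultimately show ?thesis using \<Omega> \<Omega>V unfolding frame_def n_def by blast
qed

text \<open>Describes smoothness by the digraph and the number \<open>dim UNIV\<close> alone, so it
  is transported once the dimensions are known to agree.\<close>

theorem smooth_points_eq_frames:
  assumes "finite_dimensional smul"
  shows "smooth_points smul = \<Union>{\<Omega>. frame \<Gamma> (dim UNIV) \<Omega>}"
proof (intro equalityI subsetI)
  fix v assume "v \<in> smooth_points smul"
  then show "v \<in> \<Union>{\<Omega>. frame \<Gamma> (dim UNIV) \<Omega>}" using ex_frame_extending[OF assms, of "{v}"] by auto
qed (use smooth_if_in_frame[OF assms] in auto)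

subsection \<open>Maximal faces\<close>

text \<open>A functional supporting the average \<open>x\<close> of points whose affine hull contains the face equals
  \<open>1\<close> on the whole face, so \<open>x\<close> plays the role of a relative interior point.\<close>

lemma proj_face_subset_out_dominating:
  assumes fd: "finite_dimensional smul" and "pverts \<Gamma> \<noteq> {}" and "proj_face smul \<F>"
  obtains v where "v \<in> pverts \<Gamma>" "\<F> \<subseteq> out_dominating \<Gamma> v"
proof (cases "\<F> = {}")
  case True
  then show thesis using that assms(2) by blast
next
  case False
  obtain r where r: "\<And>L. L \<in> \<F> \<Longrightarrow> r L \<noteq> 0 \<and> line smul (r L) = L" and face: "ball_face (r ` \<F>)"
    and \<F>: "\<F> \<subseteq> proj_space smul"
    using assms(3) by (auto simp: proj_face_def)
  define R where "R = r ` \<F>"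
  have R: "convex R" "R \<subseteq> sphere 0 1" using face by (auto simp: ball_face_def R_def)
  obtain p where p: "p \<in> R" using False by (auto simp: R_def)
  obtain S where S: "finite S" "span S = UNIV" using fd by (auto simp: finite_dimensional_def)
  obtain B where B: "B \<subseteq> (\<lambda>y. y - p) ` R" "independent B" "(\<lambda>y. y - p) ` R \<subseteq> span B"
    by (rule maximal_independent_subset)
  have "finite B" using independent_span_bound[OF S(1) B(2)] S(2) by simp
  \<comment> \<open>Finitely many points of \<open>R\<close> whose differences from \<open>p\<close>
    span all differences \<open>y - p\<close> with \<open>y\<close> in \<open>R\<close>. A
    functional that is 1 on \<open>P\<close> vanishes on \<open>span B\<close>, and so is 1 on
    \<open>R\<close>.\<close>
  define P where "P = insert p ((\<lambda>b. p + b) ` B)"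
  have P: "finite P" "P \<subseteq> R" "p \<in> P" using \<open>finite B\<close> B(1) p by (auto simp: P_def)
  then have cP: "card P > 0" by (auto simp: card_gt_0_iff)
  define x where "x = (\<Sum>q\<in>P. (1 / real (card P)) *\<^sub>R q)"
  have "x \<in> R"
    unfolding x_def using P R(1) cP by (intro convex_sum) auto
  then have nx: "norm x = 1" using R(2) by auto
  then have "x \<noteq> 0" by auto
  have support: "supporting_functional smul y g"
    if g: "supporting_functional smul x g" and y: "y \<in> R" for y g
  proof -
    note gD = supporting_functionalD[OF g]
    have "real (card P) *\<^sub>R x = \<Sum>P"
      using cP by (simp add: x_def flip: scaleR_sum_right)
    then have "(\<Sum>q\<in>P. g q) = g (smul (of_real (real (card P))) x)"
      by (simp add: smul_of_real gD(7) del: of_real_of_nat_eq)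
    also have "\<dots> = of_nat (card P)" by (simp add: gD(2,4) nx)
    finally have sum: "(\<Sum>q\<in>P. g q) = of_nat (card P)" .
    have one: "g q = 1" if "q \<in> P" for q
    proof (rule sum_of_bounded_eq_card[OF P(1) _ sum that])
      fix q assume "q \<in> P"
      then show "norm (g q) \<le> 1" using gD(3)[of q] P(2) R(2) by auto
    qed
    have B0: "g b = 0" if "b \<in> B" for b
    proof -
      have "g (p + b) = 1" using one[of "p + b"] that by (auto simp: P_def)
      then show ?thesis using one[OF P(3)] by (simp add: gD(1))
    qed
    have "subspace {z. g z = 0}" by (auto simp: subspace_def gD(1,2,5))
    then have "span B \<subseteq> {z. g z = 0}" using B0 by (intro span_minimal) auto
    then have "g (y - p) = 0" using B(3) y by auto
    then have "g y = 1" using one[OF P(3)] by (simp add: gD(6))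
    moreover have "norm y = 1" using R(2) y by auto
    ultimately show ?thesis by (intro supporting_functionalI gD) auto
  qed
  have "out_perp \<Gamma> (line smul x) \<subseteq> out_perp \<Gamma> L" if "L \<in> \<F>" for L
  proof
    fix V assume V: "V \<in> out_perp \<Gamma> (line smul x)"
    then have "V \<in> pverts \<Gamma>" by (simp add: out_perp_def)
    then obtain z where z: "z \<noteq> 0" "V = line smul z" by (rule pverts_cases)
    then have "bj_orthogonal smul x z" using V \<open>x \<noteq> 0\<close> line_in_out_perp_iff by simp
    then obtain g where "supporting_functional smul x g" "g z = 0"
      using bj_orthogonal_iff_supporting_functional[OF \<open>x \<noteq> 0\<close>] by blast
    moreover have "r L \<in> R" using that by (simp add: R_def)
    ultimately have "bj_orthogonal smul (r L) z"
      using support r[OF that] bj_orthogonal_iff_supporting_functional by blast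
    then show "V \<in> out_perp \<Gamma> L" using r[OF that] line_in_out_perp_iff[of "r L" z] z by simp
  qed
  then have "\<F> \<subseteq> out_dominating \<Gamma> (line smul x)"
    using \<F> by (auto simp: out_dominating_def pverts_orthodigraph)
  then show thesis using that line_in_pverts[OF \<open>x \<noteq> 0\<close>] by blast
qed

text \<open>The face exposed by \<open>f\<close>. As \<open>f\<close> is bounded by the norm, its
  value at an inner point of a segment between unit vectors can be 1 only if it is 1 at both
  ends.\<close>

lemma proj_face_of_supporting_functional:
  assumes f: "supporting_functional smul x f"
  shows "proj_face smul {line smul y | y. norm y = 1 \<and> f y = 1}" (is "proj_face smul ?\<F>")
proof -
  note fD = supporting_functionalD[OF f]
  define r where "r L = (SOME y. norm y = 1 \<and> f y = 1 \<and> line smul y = L)" for L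
  have r: "norm (r L) = 1 \<and> f (r L) = 1 \<and> line smul (r L) = L" if "L \<in> ?\<F>" for L
  proof -
    have "\<exists>y. norm y = 1 \<and> f y = 1 \<and> line smul y = L" using that by blast
    then show ?thesis unfolding r_def by (rule someI_ex)
  qed
  \<comment> \<open>A line meets the exposed face in at most one point, because \<open>f\<close>
    fixes the scalar; thus the choice \<open>r\<close> returns the given vector.\<close>
  have r_line: "r (line smul y) = y" if "norm y = 1" "f y = 1" for y
  proof -
    have ry: "f (r (line smul y)) = 1" "line smul (r (line smul y)) = line smul y"
      using r[of "line smul y"] that by blast+
    then obtain c where "r (line smul y) = smul c y" by (blast elim: line_eqE)
    then show ?thesis using ry(1) that(2) by (simp add: fD(2))
  qed
  have scale: "f (t *\<^sub>R y) = t *\<^sub>R f y" for t y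
    by (metis fD(2) scaleR_conv_of_real smul_of_real)
  have image: "r ` ?\<F> = {y. norm y = 1 \<and> f y = 1}"
  proof (intro equalityI subsetI)
    fix y assume "y \<in> {y. norm y = 1 \<and> f y = 1}"
    then show "y \<in> r ` ?\<F>" using r_line[of y] by (intro image_eqI[of _ _ "line smul y"]) auto
  qed (use r in blast)
  have unit: "norm (t *\<^sub>R y + s *\<^sub>R z) = 1"
    if "norm y \<le> 1" "norm z \<le> 1" "0 \<le> t" "0 \<le> s" "t + s = 1" "f (t *\<^sub>R y + s *\<^sub>R z) = 1" for y z t s
  proof (rule antisym)
    have "norm (t *\<^sub>R y + s *\<^sub>R z) \<le> t * norm y + s * norm z"
      using norm_triangle_ineq[of "t *\<^sub>R y" "s *\<^sub>R z"] that(3,4) by simp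
    also have "\<dots> \<le> t * 1 + s * 1" using that by (intro add_mono mult_left_mono)
    finally show "norm (t *\<^sub>R y + s *\<^sub>R z) \<le> 1" using that(5) by simp
    show "1 \<le> norm (t *\<^sub>R y + s *\<^sub>R z)" using fD(3)[of "t *\<^sub>R y + s *\<^sub>R z"] that(6) by simp
  qed
  have "ball_face {y. norm y = 1 \<and> f y = 1}"
    unfolding ball_face_def
  proof (intro conjI allI impI)
    show "convex {y. norm y = 1 \<and> f y = 1}"
    proof (rule convexI)
      fix y z and t s :: real
      assume *: "y \<in> {y. norm y = 1 \<and> f y = 1}" "z \<in> {y. norm y = 1 \<and> f y = 1}"
        "0 \<le> t" "0 \<le> s" "t + s = 1"
      then have "f (t *\<^sub>R y + s *\<^sub>R z) = t *\<^sub>R 1 + s *\<^sub>R 1" by (simp add: fD(1) scale)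
      then have "f (t *\<^sub>R y + s *\<^sub>R z) = 1" using *(5) by (simp flip: scaleR_add_left)
      then show "t *\<^sub>R y + s *\<^sub>R z \<in> {y. norm y = 1 \<and> f y = 1}" using * unit by auto
    qed
    show "{y. norm y = 1 \<and> f y = 1} \<subseteq> sphere 0 1" by auto
    fix y z
    assume "norm y = 1 \<and> norm z = 1 \<and> y \<noteq> z \<and> open_segment y z \<inter> {y. norm y = 1 \<and> f y = 1} \<noteq> {}"
    then obtain t where *: "norm y = 1" "norm z = 1" "0 < t" "t < 1" "f ((1 - t) *\<^sub>R y + t *\<^sub>R z) = 1"
      by (auto simp: in_segment)
    \<comment> \<open>Passing to real parts reduces the claim to a convex combination of two reals
      at most 1 with value 1; \<open>eq_norm_if_Re_rc_embed\<close> leads back to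
      \<open>f\<close>.\<close>
    define a b where "a = Re (rc_embed (f y))" and "b = Re (rc_embed (f z))"
    have le: "a \<le> 1" "b \<le> 1"
      using Re_rc_embed_le_norm[of "f y"] Re_rc_embed_le_norm[of "f z"] fD(3)[of y] fD(3)[of z] *(1,2)
      by (simp_all add: a_def b_def)
    have "(1 - t) * a + t * b = 1"
      using arg_cong[OF *(5), of "\<lambda>c. Re (rc_embed c)"]
      by (simp add: fD(1) scale rc_embed_add rc_embed_scaleR rc_embed_1 a_def b_def)
    then have s: "(1 - t) * (1 - a) + t * (1 - b) = 0" by (simp add: algebra_simps)
    moreover have "(1 - t) * (1 - a) \<ge> 0" "t * (1 - b) \<ge> 0" using le *(3,4) by simp_all
    ultimately have "(1 - t) * (1 - a) = 0" "t * (1 - b) = 0" by linarith+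
    then have "a = 1" "b = 1" using *(3,4) by simp_all
    then have "f y = 1" "f z = 1"
      using eq_norm_if_Re_rc_embed[of "f y" 1] eq_norm_if_Re_rc_embed[of "f z" 1] fD(3)[of y] fD(3)[of z] *(1,2)
      by (simp_all add: a_def b_def)
    then show "y \<in> {y. norm y = 1 \<and> f y = 1}" "z \<in> {y. norm y = 1 \<and> f y = 1}" using *(1,2) by simp_all
  qed
  then have "ball_face (r ` ?\<F>)" by (simp only: image)
  moreover have "?\<F> \<subseteq> proj_space smul"
  proof
    fix L assume "L \<in> ?\<F>"
    then obtain y where "L = line smul y" "norm y = 1" by blast
    moreover from this have "y \<noteq> 0" by auto
    ultimately show "L \<in> proj_space smul" using line_in_pverts[of y] by (simp add: pverts_orthodigraph)
  qed
  moreover have "\<forall>L\<in>?\<F>. r L \<noteq> 0 \<and> line smul (r L) = L"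
    using r by (metis (no_types, lifting) norm_zero zero_neq_one)
  ultimately show ?thesis unfolding proj_face_def by blast
qed

text \<open>Let \<open>f\<close> support the unit vector \<open>x\<close> of \<open>v\<close>, and
  let \<open>y\<close> represent a dominating vertex. Then \<open>z = y - smul (f y) x\<close> is in
  the kernel of \<open>f\<close>, so \<open>x\<close>, and by domination \<open>y\<close>, is
  orthogonal to \<open>z\<close>. Hence \<open>norm y \<le> norm (y - z) = norm (f y)\<close>: up to
  a scalar, \<open>y\<close> lies in the face exposed by \<open>f\<close>.\<close>

lemma out_dominating_subset_proj_face:
  assumes "v \<in> pverts \<Gamma>"
  obtains \<F> where "proj_face smul \<F>" "out_dominating \<Gamma> v \<subseteq> \<F>"
proof -
  obtain x where x: "norm x = 1" "v = line smul x"
  proof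
    show "norm (rep v /\<^sub>R norm (rep v)) = 1" using rep(1)[OF assms] by simp
    have "line smul (smul (of_real (inverse (norm (rep v)))) (rep v)) = v"
      using rep[OF assms] by (subst line_smul) auto
    then show "v = line smul (rep v /\<^sub>R norm (rep v))" by (simp only: smul_of_real)
  qed
  then have "x \<noteq> 0" by auto
  obtain f where f: "supporting_functional smul x f" using ex_supporting_functional[OF \<open>x \<noteq> 0\<close>] .
  note fD = supporting_functionalD[OF f]
  have fx: "f x = 1" using fD(4) x(1) by simp
  have "L \<in> {line smul y | y. norm y = 1 \<and> f y = 1}" if L: "L \<in> out_dominating \<Gamma> v" for L
  proof -
    have "L \<in> pverts \<Gamma>" using L by (simp add: out_dominating_def)
    then obtain y where y: "y \<noteq> 0" "L = line smul y" by (rule pverts_cases)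
    define z where "z = y - smul (f y) x"
    have "f z = 0" by (simp add: z_def fD(2,6) fx)
    have "bj_orthogonal smul y z"
    proof (cases "z = 0")
      case False
      have "line smul z \<in> out_perp \<Gamma> v"
        using x \<open>x \<noteq> 0\<close> False f \<open>f z = 0\<close> line_in_out_perp_iff bj_orthogonal_iff_supporting_functional
        by blast
      then have "line smul z \<in> out_perp \<Gamma> L" using L by (auto simp: out_dominating_def)
      then show ?thesis using y False line_in_out_perp_iff by simp
    qed (simp add: bj_orthogonal_def)
    then have "norm y \<le> norm (y + smul (- 1) z)" unfolding bj_orthogonal_def by blast
    also have "y + smul (- 1) z = smul (f y) x" by (simp add: z_def)
    finally have "norm y \<le> norm (f y)" by (simp add: norm_smul x(1))
    then have ny: "norm y = norm (f y)" using fD(3)[of y] by simp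
    then have "f y \<noteq> 0" using y(1) by auto
    define u where "u = smul (inverse (f y)) y"
    have "norm u = 1" "f u = 1"
      using \<open>f y \<noteq> 0\<close> y(1) by (simp_all add: u_def norm_smul norm_inverse fD(2) ny)
    moreover have "L = line smul u" using \<open>f y \<noteq> 0\<close> y(2) by (simp add: u_def line_smul)
    ultimately show ?thesis by blast
  qed
  then show thesis using that proj_face_of_supporting_functional[OF f] by blast
qed

text \<open>Each face lies in a dominating set and each dominating set in a face, so the two
  families have the same maximal members. A vertex is required to cover the empty face.\<close>

theorem maximal_faces_eq_max_dominating:
  assumes fd: "finite_dimensional smul" and ne: "pverts \<Gamma> \<noteq> {}"
  shows "maximal_faces smul = max_dominating \<Gamma>"
proof (intro equalityI subsetI)
  fix \<F> assume "\<F> \<in> maximal_faces smul"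
  then have \<F>: "proj_face smul \<F>" and max: "\<And>\<G>. proj_face smul \<G> \<Longrightarrow> \<F> \<subseteq> \<G> \<Longrightarrow> \<G> = \<F>"
    by (auto simp: maximal_faces_def)
  obtain v where v: "v \<in> pverts \<Gamma>" "\<F> \<subseteq> out_dominating \<Gamma> v"
    using proj_face_subset_out_dominating[OF fd ne \<F>] .
  have eq: "out_dominating \<Gamma> w = \<F>" if w: "w \<in> pverts \<Gamma>" "\<F> \<subseteq> out_dominating \<Gamma> w" for w
  proof -
    obtain \<G> where \<G>: "proj_face smul \<G>" "out_dominating \<Gamma> w \<subseteq> \<G>"
      using out_dominating_subset_proj_face[OF w(1)] .
    then have "\<G> = \<F>" using max[OF \<G>(1)] w(2) by simp
    then show ?thesis using \<G>(2) w(2) by simp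
  qed
  have "\<not> out_dominating \<Gamma> v \<subset> out_dominating \<Gamma> w" if "w \<in> pverts \<Gamma>" for w
    using eq[OF v] eq[OF that] by auto
  then show "\<F> \<in> max_dominating \<Gamma>"
    unfolding max_dominating_def using v(1) eq[OF v] by auto
next
  fix S assume "S \<in> max_dominating \<Gamma>"
  then obtain v where v: "v \<in> pverts \<Gamma>" "S = out_dominating \<Gamma> v"
    and max: "\<And>w. w \<in> pverts \<Gamma> \<Longrightarrow> \<not> S \<subset> out_dominating \<Gamma> w"
    by (auto simp: max_dominating_def)
  have eq: "\<G> = S" if \<G>: "proj_face smul \<G>" "S \<subseteq> \<G>" for \<G>
  proof -
    obtain w where w: "w \<in> pverts \<Gamma>" "\<G> \<subseteq> out_dominating \<Gamma> w"
      using proj_face_subset_out_dominating[OF fd ne \<G>(1)] .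
    then show ?thesis using max[OF w(1)] \<G>(2) by auto
  qed
  obtain \<F> where \<F>: "proj_face smul \<F>" "S \<subseteq> \<F>"
    using out_dominating_subset_proj_face[OF v(1)] unfolding v(2) .
  then have "proj_face smul S" using eq[OF \<F>] by simp
  then show "S \<in> maximal_faces smul" using eq unfolding maximal_faces_def by auto
qed

text \<open>The zero space is treated apart: the empty set is then a maximal face, whereas
  \<open>max_dominating\<close> has no member.\<close>

lemma maximal_faces_if_no_vertex:
  assumes "pverts \<Gamma> = {}"
  shows "maximal_faces smul = {{}}"
proof -
  have "proj_face smul \<F> \<longleftrightarrow> \<F> = {}" for \<F>
    using assms by (auto simp: proj_face_def ball_face_def pverts_orthodigraph)
  then show ?thesis by (auto simp: maximal_faces_def)
qed

end

section \<open>Transfer along an isomorphism of orthodigraphs\<close>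

lemma ex_common_out_empty_if_digraph_dim_finite:
  assumes "digraph_dim G < \<infinity>"
  obtains \<Omega> where "finite \<Omega>" "\<Omega> \<subseteq> pverts G" "common_out G \<Omega> = {}"
proof -
  have "{enat (card \<Omega>) | \<Omega>. finite \<Omega> \<and> \<Omega> \<subseteq> pverts G \<and> pverts G \<inter> (\<Inter>x\<in>\<Omega>. out_perp G x) = {}} \<noteq> {}"
  proof
    assume "{enat (card \<Omega>) | \<Omega>. finite \<Omega> \<and> \<Omega> \<subseteq> pverts G \<and>
      pverts G \<inter> (\<Inter>x\<in>\<Omega>. out_perp G x) = {}} = {}"
    \<comment> \<open>Both branches of the definition give infinity: the first by fiat, the second
      as an infimum over the empty set.\<close>
    then have "digraph_dim G = \<infinity>" unfolding digraph_dim_def by (simp only: Inf_enat_def) simp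
    then show False using assms by simp
  qed
  then show thesis using that unfolding common_out_def by blast
qed

context
  fixes sX :: "'f::real_or_complex \<Rightarrow> 'x::real_normed_vector \<Rightarrow> 'x"
    and sY :: "'f \<Rightarrow> 'y::real_normed_vector \<Rightarrow> 'y"
    and \<phi> :: "'x set \<Rightarrow> 'y set"
  assumes X: "normed_space_over sX" and Y: "normed_space_over sY"
    and iso: "digraph_isomorphism (orthodigraph sX) (orthodigraph sY) \<phi>"
    and fd: "finite_dimensional sX"
begin

interpretation X: normed_space_over sX by (rule X)
interpretation Y: normed_space_over sY by (rule Y)

text \<open>The image of a frame still has no common out-neighbour, so its cardinality bounds the
  dimension of the target. Equality follows later by symmetry.\<close>

lemma isomorphic_finite_dimensional:
  "finite_dimensional sY" "vector_space.dim sY UNIV \<le> vector_space.dim sX UNIV"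
proof -
  obtain \<Omega> where \<Omega>: "finite \<Omega>" "\<Omega> \<subseteq> pverts X.\<Gamma>" "card \<Omega> = X.dim UNIV" "common_out X.\<Gamma> \<Omega> = {}"
    using X.ex_frame_extending[OF fd, of "{}"] by (auto simp: frame_def)
  have *: "finite (\<phi> ` \<Omega>)" "\<phi> ` \<Omega> \<subseteq> pverts Y.\<Gamma>" "common_out Y.\<Gamma> (\<phi> ` \<Omega>) = {}"
    using \<Omega> iso_image_pverts[OF iso] iso_common_out[OF iso \<Omega>(2)] by auto
  show "finite_dimensional sY" by (rule Y.finite_dimensional_if_common_out_empty[OF *])
  have "Y.dim UNIV \<le> card (\<phi> ` \<Omega>)" by (rule Y.finite_dimensional_if_common_out_empty[OF *])
  also have "\<dots> \<le> X.dim UNIV" using card_image_le[OF \<Omega>(1)] \<Omega>(3) by metis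
  finally show "Y.dim UNIV \<le> X.dim UNIV" .
qed

lemma isomorphic_image_smooth_points:
  assumes "Y.dim UNIV = X.dim UNIV"
  shows "\<phi> ` smooth_points sX \<subseteq> smooth_points sY"
  using X.smooth_points_eq_frames[OF fd] Y.smooth_points_eq_frames[OF isomorphic_finite_dimensional(1)]
    iso_frame[OF iso] assms by fastforce

lemma isomorphic_image_maximal_faces:
  "(\<lambda>\<F>. \<phi> ` \<F>) ` maximal_faces sX \<subseteq> maximal_faces sY"
proof (cases "pverts X.\<Gamma> = {}")
  case True
  then show ?thesis
    using X.maximal_faces_if_no_vertex Y.maximal_faces_if_no_vertex iso_image_pverts[OF iso] by auto
next
  case False
  then have "pverts Y.\<Gamma> \<noteq> {}" using iso_image_pverts[OF iso] by blast
  then show ?thesis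
    using X.maximal_faces_eq_max_dominating[OF fd False] iso_max_dominating[OF iso]
      Y.maximal_faces_eq_max_dominating[OF isomorphic_finite_dimensional(1)] by auto
qed

end

lemma maximal_faces_subset_pverts: "\<F> \<in> maximal_faces smul \<Longrightarrow> \<F> \<subseteq> pverts (orthodigraph smul)"
  by (simp add: maximal_faces_def proj_face_def orthodigraph_def)

theorem theorem1p3:
  fixes scaleX :: "'f::real_or_complex \<Rightarrow> 'x::real_normed_vector \<Rightarrow> 'x"
    and scaleY :: "'f \<Rightarrow> 'y::real_normed_vector \<Rightarrow> 'y"
    and \<phi> :: "'x set \<Rightarrow> 'y set"
  assumes "normed_space_over scaleX"
    and "normed_space_over scaleY"
    and "digraph_dim (orthodigraph scaleX) < \<infinity>"
    and "digraph_isomorphism (orthodigraph scaleX) (orthodigraph scaleY) \<phi>"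
  shows "\<phi> ` smooth_points scaleX = smooth_points scaleY \<and>
    (\<lambda>\<F>. \<phi> ` \<F>) ` maximal_faces scaleX = maximal_faces scaleY \<and>
    finite_dimensional scaleX \<and>
    finite_dimensional scaleY \<and>
    vector_space.dim scaleX UNIV = vector_space.dim scaleY UNIV"
proof -
  note X = assms(1) and Y = assms(2) and iso = assms(4)
  interpret X: normed_space_over scaleX by (rule X)
  interpret Y: normed_space_over scaleY by (rule Y)
  \<comment> \<open>The inverse isomorphism supplies the opposite dimension inequality and the
    surjectivity on smooth points and on maximal faces.\<close>
  define \<psi> where "\<psi> = the_inv_into (pverts X.\<Gamma>) \<phi>"
  have iso': "digraph_isomorphism Y.\<Gamma> X.\<Gamma> \<psi>"
    unfolding \<psi>_def by (rule digraph_isomorphism_the_inv_into[OF iso])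
  have \<phi>\<psi>: "\<phi> (\<psi> v) = v" if "v \<in> pverts Y.\<Gamma>" for v
    using f_the_inv_into_f[OF iso_inj_on[OF iso]] that by (simp add: \<psi>_def iso_image_pverts[OF iso])
  obtain \<Omega> where "finite \<Omega>" "\<Omega> \<subseteq> pverts X.\<Gamma>" "common_out X.\<Gamma> \<Omega> = {}"
    using ex_common_out_empty_if_digraph_dim_finite[OF assms(3)] .
  then have fdX: "finite_dimensional scaleX" by (rule X.finite_dimensional_if_common_out_empty)
  note fdY = isomorphic_finite_dimensional(1)[OF X Y iso fdX]
  have dim: "X.dim UNIV = Y.dim UNIV"
    using isomorphic_finite_dimensional(2)[OF X Y iso fdX] isomorphic_finite_dimensional(2)[OF Y X iso' fdY]
    by simp
  have "\<phi> ` smooth_points scaleX = smooth_points scaleY"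
  proof (intro equalityI subsetI)
    fix v assume v: "v \<in> smooth_points scaleY"
    then have "\<psi> v \<in> smooth_points scaleX"
      using isomorphic_image_smooth_points[OF Y X iso' fdY dim] by blast
    then show "v \<in> \<phi> ` smooth_points scaleX"
      using \<phi>\<psi> v Y.smooth_points_subset by (intro image_eqI[of _ _ "\<psi> v"]) auto
  qed (use isomorphic_image_smooth_points[OF X Y iso fdX dim[symmetric]] in blast)
  moreover have "(\<lambda>\<F>. \<phi> ` \<F>) ` maximal_faces scaleX = maximal_faces scaleY"
  proof (intro equalityI subsetI)
    fix \<F> assume \<F>: "\<F> \<in> maximal_faces scaleY"
    then have "\<psi> ` \<F> \<in> maximal_faces scaleX"
      using isomorphic_image_maximal_faces[OF Y X iso' fdY] by blast
    moreover have "\<F> = \<phi> ` \<psi> ` \<F>"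
      using \<phi>\<psi> maximal_faces_subset_pverts[OF \<F>] by (force simp: image_image)
    ultimately show "\<F> \<in> (\<lambda>\<F>. \<phi> ` \<F>) ` maximal_faces scaleX" by blast
  qed (use isomorphic_image_maximal_faces[OF X Y iso fdX] in blast)
  ultimately show ?thesis using fdX fdY dim by blast
qed

end
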